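(* Let $n\ge1$, $\alpha\in(0,1)$, $p\in\left[1,\frac{n}{n-\alpha}\right)$ and $f\in BV^{\alpha,p}_+(\mathbb{R}^n)$. Assume that at least one of the following holds: (1) $\operatorname{supp}|D^\alpha f|$ is bounded; (2) $|D^\alpha f|\big(\overline{H_\nu^+(x_0)}\big)=0$ for some $x_0\in\mathbb{R}^n$ and $\nu\in\mathbb{S}^{n-1}$; (3) $f\in L^\infty(\mathbb{R}^n)$ and $D^\alpha f(H^+_\nu(x_0))=0$ for some $x_0\in\mathbb{R}^n$ and $\nu\in\mathbb{S}^{n-1}$. Then $f\equiv0$ (almost everywhere).
   Context: Let $\mu_{n,\alpha}=2^{\alpha}\pi^{-n/2}\,\Gamma\left(\frac{n+\alpha+1}{2}\right)/\Gamma\left(\frac{1-\alpha}{2}\right)$. For $\varphi\in \mathrm{Lip}_c(\mathbb{R}^n;\mathbb{R}^n)$ (compactly supported Lipschitz), the fractional $\alpha$-divergence is $$\mathrm{div}^\alpha\varphi(x)=\mu_{n,\alpha}\int_{\mathbb{R}^n}\frac{(y-x)\cdot(\varphi(y)-\varphi(x))}{|y-x|^{n+\alpha+1}}\,dy,\quad x\in\mathbb{R}^n.$$ For $p\in[1,+\infty]$ and $f\in L^p(\mathbb{R}^n)$ let $$|D^\alpha f|(\mathbb{R}^n)=\sup\left\{\int_{\mathbb{R}^n} f\,\mathrm{div}^\alpha\varphi\,dx:\varphi\in C^\infty_c(\mathbb{R}^n;\mathbb{R}^n),\ \|\varphi\|_{L^\infty(\mathbb{R}^n;\mathbb{R}^n)}\le1\right\},$$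 $BV^{\alpha,p}(\mathbb{R}^n)=\{f\in L^p(\mathbb{R}^n):|D^\alpha f|(\mathbb{R}^n)<+\infty\}$ and $BV^{\alpha,p}_+(\mathbb{R}^n)=\{f\in BV^{\alpha,p}(\mathbb{R}^n):f\ge0\}$. A function $f\in L^p(\mathbb{R}^n)$ belongs to $BV^{\alpha,p}(\mathbb{R}^n)$ if and only if there is a (unique) finite $\mathbb{R}^n$-valued Radon measure $D^\alpha f$ on $\mathbb{R}^n$ with $\int_{\mathbb{R}^n} f\,\mathrm{div}^\alpha\varphi\,dx=-\int_{\mathbb{R}^n}\varphi\cdot dD^\alpha f$ for all $\varphi\in \mathrm{Lip}_c(\mathbb{R}^n;\mathbb{R}^n)$; $|D^\alpha f|$ denotes its total variation measure. For $\nu\in\mathbb{S}^{n-1}$ and $x_0\in\mathbb{R}^n$, $H_\nu^+(x_0)=\{y\in\mathbb{R}^n:(y-x_0)\cdot\nu>0\}$. *)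

theory Defs
  imports "HOL-Analysis.Analysis"
begin

section \<open>Function spaces\<close>

text \<open>Membership of a representative in $L^p$, $1 \le p \le \infty$; functions are not identified
  almost everywhere.\<close>

definition Lp :: "ennreal \<Rightarrow> ('a::euclidean_space \<Rightarrow> real) set" where
  "Lp p = {f \<in> borel_measurable lebesgue.
     if p = \<infinity> then (\<exists>C. AE x in lebesgue. \<bar>f x\<bar> \<le> C)
     else integrable lebesgue (\<lambda>x. \<bar>f x\<bar> powr enn2real p)}"

definition compactly_supported :: "('a::topological_space \<Rightarrow> 'b::zero) \<Rightarrow> bool" where
  "compactly_supported \<phi> \<longleftrightarrow> compact (closure {x. \<phi> x \<noteq> 0})"

definition Lip_c :: "('a::euclidean_space \<Rightarrow> 'a) set" where
  "Lip_c = {\<phi>. (\<exists>L. L-lipschitz_on UNIV \<phi>) \<and> compactly_supported \<phi>}"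

text \<open>All iterated directional derivatives up to order \<open>k\<close> exist and are continuous; in finite
  dimension this is the class $C^k$.\<close>

primrec Ck :: "nat \<Rightarrow> ('a::euclidean_space \<Rightarrow> 'b::real_normed_vector) \<Rightarrow> bool" where
  "Ck 0 \<phi> \<longleftrightarrow> continuous_on UNIV \<phi>"
| "Ck (Suc k) \<phi> \<longleftrightarrow> (\<forall>x. \<phi> differentiable (at x)) \<and>
     (\<forall>v. Ck k (\<lambda>x. frechet_derivative \<phi> (at x) v))"

definition Cinf_c :: "('a::euclidean_space \<Rightarrow> 'a) set" where
  "Cinf_c = {\<phi>. (\<forall>k. Ck k \<phi>) \<and> compactly_supported \<phi>}"


section \<open>Vector measures\<close>

text \<open>A finite vector-valued Radon measure on a Euclidean space is a countably additive function on
  the Borel sets. Values outside the Borel sets are irrelevant everywhere below.\<close>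

definition vector_measure :: "('a::topological_space set \<Rightarrow> 'b::real_normed_vector) \<Rightarrow> bool" where
  "vector_measure D \<longleftrightarrow> (\<forall>E::nat \<Rightarrow> 'a set. range E \<subseteq> sets borel \<longrightarrow> disjoint_family E \<longrightarrow>
     (\<lambda>i. D (E i)) sums D (\<Union>i. E i))"

definition variation ::
    "('a::topological_space set \<Rightarrow> 'b::real_normed_vector) \<Rightarrow> 'a set \<Rightarrow> ennreal" where
  "variation D B = (SUP E \<in> {E::nat \<Rightarrow> 'a set. range E \<subseteq> sets borel \<and> disjoint_family E \<and>
     (\<Union>i. E i) = B}. \<Sum>i. ennreal (norm (D (E i))))"

definition variation_support ::
    "('a::topological_space set \<Rightarrow> 'b::real_normed_vector) \<Rightarrow> 'a set" where
  "variation_support D = {x. \<forall>U. open U \<longrightarrow> x \<in> U \<longrightarrow> variation D U > 0}"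

text \<open>The positive part $\mu^+$ in the Jordan decomposition of a real-valued measure $\mu$;
  the negative part is $(-\mu)^+$. Note that \<^const>\<open>ennreal\<close> sends negative numbers to \<open>0\<close>,
  which does not change the supremum as \<open>A = {}\<close> is admissible.\<close>

definition upper_variation :: "('a::topological_space set \<Rightarrow> real) \<Rightarrow> 'a set \<Rightarrow> ennreal" where
  "upper_variation \<mu> B = (SUP A \<in> {A \<in> sets borel. A \<subseteq> B}. ennreal (\<mu> A))"

definition positive_part :: "('a::topological_space set \<Rightarrow> real) \<Rightarrow> 'a measure" where
  "positive_part \<mu> = measure_of UNIV (sets borel) (upper_variation \<mu>)"

lemma space_positive_part [simp]: "space (positive_part \<mu>) = UNIV"
  by (simp add: positive_part_def)

lemma sets_positive_part [simp, measurable_cong]: "sets (positive_part \<mu>) = sets borel"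
  using sets.sigma_sets_eq[of borel] by (simp add: positive_part_def)

lemma upper_variation_mono: "B \<subseteq> C \<Longrightarrow> upper_variation \<mu> B \<le> upper_variation \<mu> C"
  unfolding upper_variation_def by (rule SUP_subset_mono) auto

lemma vector_measure_empty:
  assumes "vector_measure D" shows "D {} = 0"
proof -
  have "(\<lambda>i::nat. D {}) sums D {}"
    using assms unfolding vector_measure_def
    by (auto dest!: spec[of _ "\<lambda>_. {}"] simp: disjoint_family_on_def)
  then show ?thesis
    using sums_summable summable_const_iff by blast
qed

lemma vector_measure_Un:
  assumes D: "vector_measure D" and "A \<in> sets borel" "B \<in> sets borel" "A \<inter> B = {}"
  shows "D (A \<union> B) = D A + D B"
proof -
  have "range (binaryset A B) \<subseteq> sets borel" "disjoint_family (binaryset A B)"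
    using assms by (auto simp: binaryset_def disjoint_family_on_def)
  then have "(\<lambda>i. D (binaryset A B i)) sums D (A \<union> B)"
    using D unfolding vector_measure_def by (metis UN_binaryset_eq)
  moreover have "(\<lambda>i. D (binaryset A B i)) sums (D A + D B)"
    using binaryset_sums[of D A B] vector_measure_empty[OF D] by blast
  ultimately show ?thesis by (rule sums_unique2)
qed

lemma emeasure_positive_part:
  assumes L: "vector_measure \<mu>" and B: "B \<in> sets borel"
  shows "emeasure (positive_part \<mu>) B = upper_variation \<mu> B"
proof -
  have emp: "upper_variation \<mu> {} = 0"
    using vector_measure_empty[OF L] by (auto simp: upper_variation_def)
  have add: "upper_variation \<mu> A + upper_variation \<mu> C \<le> upper_variation \<mu> (A \<union> C)"
    if AC: "A \<inter> C = {}" for A C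
  proof -
    have *: "ennreal (\<mu> X) + ennreal (\<mu> Y) \<le> upper_variation \<mu> (A \<union> C)"
      if X: "X \<in> sets borel" "X \<subseteq> A" and Y: "Y \<in> sets borel" "Y \<subseteq> C" for X Y
    proof -
      have up: "ennreal (\<mu> Z) \<le> upper_variation \<mu> (A \<union> C)" if "Z \<in> sets borel" "Z \<subseteq> A \<union> C" for Z
        using that unfolding upper_variation_def by (auto intro: SUP_upper)
      show ?thesis
      proof (cases "\<mu> X \<le> 0 \<or> \<mu> Y \<le> 0")
        case True
        then show ?thesis using up[of X] up[of Y] X Y le_supI1[of X A C] le_supI2[of Y C A]
          by (auto simp: ennreal_neg)
      next
        case False
        moreover have "\<mu> (X \<union> Y) = \<mu> X + \<mu> Y"
          using X Y AC by (intro vector_measure_Un[OF L]) auto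
        moreover have "ennreal (\<mu> (X \<union> Y)) \<le> upper_variation \<mu> (A \<union> C)"
          using X Y by (intro up) auto
        ultimately show ?thesis by simp
      qed
    qed
    let ?S = "\<lambda>S. {X \<in> sets borel. X \<subseteq> S}"
    have "upper_variation \<mu> A + upper_variation \<mu> C =
        (SUP X \<in> ?S A. ennreal (\<mu> X) + upper_variation \<mu> C)"
      unfolding upper_variation_def[of \<mu> A] by (rule ennreal_SUP_add_left[symmetric]) auto
    also have "\<dots> = (SUP X \<in> ?S A. SUP Y \<in> ?S C. ennreal (\<mu> X) + ennreal (\<mu> Y))"
      unfolding upper_variation_def[of \<mu> C]
      by (rule SUP_cong[OF refl], rule ennreal_SUP_add_right) auto
    also have "\<dots> \<le> upper_variation \<mu> (A \<union> C)"
      by (intro SUP_least) (auto intro: *)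
    finally show ?thesis .
  qed
  have "countably_additive (sets borel) (upper_variation \<mu>)"
    unfolding countably_additive_def
  proof (intro allI impI)
    fix E :: "nat \<Rightarrow> 'a set"
    assume E: "range E \<subseteq> sets borel" and dis: "disjoint_family E"
    have "(\<Sum>i. upper_variation \<mu> (E i)) \<le> upper_variation \<mu> (\<Union>i. E i)"
    proof (rule suminf_le_const[OF summableI])
      fix n
      have "(\<Sum>i<n. upper_variation \<mu> (E i)) \<le> upper_variation \<mu> (\<Union>i<n. E i)"
      proof (induction n)
        case (Suc n)
        have "E i \<inter> E n = {}" if "i < n" for i
          using disjoint_family_onD[OF dis] that by simp
        then have "(\<Union>i<n. E i) \<inter> E n = {}"
          by blast
        from order_trans[OF add_right_mono[OF Suc] add[OF this]]
        have "(\<Sum>i<Suc n. upper_variation \<mu> (E i)) \<le> upper_variation \<mu> ((\<Union>i<n. E i) \<union> E n)"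
          by simp
        also have "(\<Union>i<n. E i) \<union> E n = (\<Union>i<Suc n. E i)"
          by (auto simp: less_Suc_eq)
        finally show ?case .
      qed (simp add: emp)
      also have "\<dots> \<le> upper_variation \<mu> (\<Union>i. E i)"
        by (rule upper_variation_mono) auto
      finally show "(\<Sum>i<n. upper_variation \<mu> (E i)) \<le> upper_variation \<mu> (\<Union>i. E i)" .
    qed
    moreover have "upper_variation \<mu> (\<Union>i. E i) \<le> (\<Sum>i. upper_variation \<mu> (E i))"
      unfolding upper_variation_def[of \<mu> "\<Union>i. E i"]
    proof (rule SUP_least, clarify)
      fix A assume A: "A \<in> sets borel" "A \<subseteq> (\<Union>i. E i)"
      have "range (\<lambda>i. A \<inter> E i) \<subseteq> sets borel" "disjoint_family (\<lambda>i. A \<inter> E i)"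
        using A E disjoint_family_subset[OF dis, of "\<lambda>i. A \<inter> E i"] by auto
      moreover have "(\<Union>i. A \<inter> E i) = A" using A by auto
      ultimately have sm: "(\<lambda>i. \<mu> (A \<inter> E i)) sums \<mu> A"
        using L unfolding vector_measure_def by metis
      have "(\<lambda>n. ennreal (\<Sum>i<n. \<mu> (A \<inter> E i))) \<longlonglongrightarrow> ennreal (\<mu> A)"
        using sm unfolding sums_def by (rule tendsto_ennrealI)
      moreover have "ennreal (\<Sum>i<n. \<mu> (A \<inter> E i)) \<le> (\<Sum>i. upper_variation \<mu> (E i))" for n
      proof -
        have "ennreal (\<Sum>i<n. \<mu> (A \<inter> E i)) \<le> ennreal (\<Sum>i<n. max 0 (\<mu> (A \<inter> E i)))"
          by (intro ennreal_leI sum_mono) auto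
        also have "\<dots> = (\<Sum>i<n. ennreal (\<mu> (A \<inter> E i)))"
          by (subst sum_ennreal[symmetric], simp, intro sum.cong)
             (auto simp: max_def ennreal_neg)
        also have "\<dots> \<le> (\<Sum>i<n. upper_variation \<mu> (E i))"
          using A E by (intro sum_mono) (auto simp: upper_variation_def intro!: SUP_upper)
        also have "\<dots> \<le> (\<Sum>i. upper_variation \<mu> (E i))"
          by (intro sum_le_suminf) (auto simp: summableI)
        finally show ?thesis .
      qed
      ultimately show "ennreal (\<mu> A) \<le> (\<Sum>i. upper_variation \<mu> (E i))"
        by (intro LIMSEQ_le_const2) auto
    qed
    ultimately show "(\<Sum>i. upper_variation \<mu> (E i)) = upper_variation \<mu> (\<Union>i. E i)"
      by (rule antisym)
  qed
  then show ?thesis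
    using emp B sets_positive_part[of \<mu>]
    by (intro emeasure_measure_of[OF positive_part_def])
       (auto simp: positive_def simp del: sets_positive_part)
qed

definition signed_integral :: "('a::topological_space set \<Rightarrow> real) \<Rightarrow> ('a \<Rightarrow> real) \<Rightarrow> real" where
  "signed_integral \<mu> u =
     (LINT x|positive_part \<mu>. u x) - (LINT x|positive_part (\<lambda>A. - \<mu> A). u x)"

text \<open>$\int \varphi \cdot dD$\<close>

definition vector_integral ::
    "('a::euclidean_space set \<Rightarrow> 'a) \<Rightarrow> ('a \<Rightarrow> 'a) \<Rightarrow> real" where
  "vector_integral D \<phi> = (\<Sum>b\<in>Basis. signed_integral (\<lambda>A. D A \<bullet> b) (\<lambda>x. \<phi> x \<bullet> b))"


section \<open>Fractional variation\<close>

definition frac_const :: "nat \<Rightarrow> real \<Rightarrow> real" where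
  "frac_const n \<alpha> = 2 powr \<alpha> * pi powr (- real n / 2) *
     Gamma ((real n + \<alpha> + 1) / 2) / Gamma ((1 - \<alpha>) / 2)"

definition frac_div :: "real \<Rightarrow> ('a::euclidean_space \<Rightarrow> 'a) \<Rightarrow> 'a \<Rightarrow> real" where
  "frac_div \<alpha> \<phi> x = frac_const DIM('a) \<alpha> *
     (LINT y|lebesgue. ((y - x) \<bullet> (\<phi> y - \<phi> x)) / norm (y - x) powr (real DIM('a) + \<alpha> + 1))"

definition frac_total_variation :: "real \<Rightarrow> ('a::euclidean_space \<Rightarrow> real) \<Rightarrow> ereal" where
  "frac_total_variation \<alpha> f = (SUP \<phi> \<in> {\<phi> \<in> Cinf_c. AE x in lebesgue. norm (\<phi> x) \<le> 1}.
     ereal (LINT x|lebesgue. f x * frac_div \<alpha> \<phi> x))"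

definition BV :: "real \<Rightarrow> ennreal \<Rightarrow> ('a::euclidean_space \<Rightarrow> real) set" where
  "BV \<alpha> p = {f \<in> Lp p. frac_total_variation \<alpha> f < \<infinity>}"

definition BV_plus :: "real \<Rightarrow> ennreal \<Rightarrow> ('a::euclidean_space \<Rightarrow> real) set" where
  "BV_plus \<alpha> p = {f \<in> BV \<alpha> p. AE x in lebesgue. f x \<ge> 0}"

text \<open>\<open>D\<close> is the fractional variation measure $D^\alpha f$. For \<open>f \<in> BV \<alpha> p\<close> such a \<open>D\<close> exists and is
  uniquely determined on the Borel sets.\<close>

definition has_frac_variation ::
    "('a::euclidean_space \<Rightarrow> real) \<Rightarrow> real \<Rightarrow> ('a set \<Rightarrow> 'a) \<Rightarrow> bool" where
  "has_frac_variation f \<alpha> D \<longleftrightarrow> vector_measure D \<and>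
     (\<forall>\<phi>\<in>Lip_c. (LINT x|lebesgue. f x * frac_div \<alpha> \<phi> x) = - vector_integral D \<phi>)"

definition halfspace :: "'a::euclidean_space \<Rightarrow> 'a \<Rightarrow> 'a set" where
  "halfspace \<nu> x0 = {y. (y - x0) \<bullet> \<nu> > 0}"

end

theory Submission
  imports Defs
begin

text \<open>Test \<open>D\<close> against \<open>\<phi>\<^sub>k = \<psi>\<^sub>k \<eta>\<^sub>k \<nu>\<close>, where the ramp \<open>\<psi>\<^sub>k\<close> increases in direction
  \<open>\<nu>\<close> to the indicator of the open half-space and \<open>\<eta>\<^sub>k\<close> is a tent of radius \<open>k\<close>. Writing
  \<open>\<psi>(y)\<eta>(y) - \<psi>(x)\<eta>(x) = (\<psi>(y) - \<psi>(x))\<eta>(y) + \<psi>(x)(\<eta>(y) - \<eta>(x))\<close> splits the fractional divergence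
  of \<open>\<phi>\<^sub>k\<close> into a nonnegative part and an error. The error has supremum norm of order
  \<open>k powr - \<alpha>\<close> and $L^1$ norm of order \<open>k powr (n - \<alpha>)\<close>, so its pairing with \<open>f\<close> tends to \<open>0\<close>
  because \<open>p < n / (n - \<alpha>)\<close>. If \<open>D\<close> is zero on the half-space, the pairing of \<open>\<phi>\<^sub>k\<close> with \<open>D\<close>
  tends to \<open>0\<close> too, and by Fatou's lemma the integral of \<open>f(x)\<close> against a kernel that is positive
  across the boundary of the half-space vanish. All three alternatives provide such a half-space.\<close>

section \<open>Finite vector measures\<close>

text \<open>A set of infinite upper variation contains another such set whose removed part has
  measure at least 1 in absolute value. Iterating gives a decreasing sequence with disjoint
  successive differences, and countable additivity would make the measures of these differences
  summable.\<close>

lemma upper_variation_finite: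
  assumes L: "vector_measure \<mu>"
  shows "upper_variation \<mu> UNIV < \<infinity>"
proof (rule ccontr)
  assume nf: "\<not> upper_variation \<mu> UNIV < \<infinity>"
  define bad where "bad B \<longleftrightarrow> B \<in> sets borel \<and> upper_variation \<mu> B = \<infinity>" for B
  have step: "\<exists>A. bad A \<and> A \<subseteq> B \<and> \<bar>\<mu> (B - A)\<bar> \<ge> 1" if B: "bad B" for B
  proof -
    \<comment> \<open>The surplus \<open>\<bar>\<mu> B\<bar> + 1\<close> gives both \<open>A\<close>
      and \<open>B - A\<close> measure at least 1 in absolute value. At least one of them again has
      infinite upper variation, so it can be kept and the other removed.\<close>
    have "ennreal (\<bar>\<mu> B\<bar> + 1) < upper_variation \<mu> B"
      using B by (simp add: bad_def ennreal_less_top)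
    then obtain A where A: "A \<in> sets borel" "A \<subseteq> B" and "ennreal (\<bar>\<mu> B\<bar> + 1) < ennreal (\<mu> A)"
      unfolding upper_variation_def less_SUP_iff by auto
    then have gt: "\<bar>\<mu> B\<bar> + 1 < \<mu> A"
      by (subst (asm) ennreal_less_iff) auto
    have Bb: "B \<in> sets borel" using B by (simp add: bad_def)
    have "\<mu> (A \<union> (B - A)) = \<mu> A + \<mu> (B - A)"
      using A Bb by (intro vector_measure_Un[OF L]) auto
    moreover have AB: "A \<union> (B - A) = B" using A by auto
    ultimately have ge: "\<bar>\<mu> (B - A)\<bar> \<ge> 1" using gt by simp
    show ?thesis
    proof (cases "bad A")
      case True
      then show ?thesis using A ge by auto
    next
      case False
      have "emeasure (positive_part \<mu>) A + emeasure (positive_part \<mu>) (B - A) =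
          emeasure (positive_part \<mu>) B"
        using plus_emeasure[of A "positive_part \<mu>" "B - A"] A Bb by (simp only: AB) auto
      then have "upper_variation \<mu> A + upper_variation \<mu> (B - A) = upper_variation \<mu> B"
        using A Bb by (simp add: emeasure_positive_part[OF L] sets.Diff)
      then have "bad (B - A)"
        using False A Bb B by (auto simp: bad_def)
      moreover have "B - (B - A) = A" using A by auto
      ultimately show ?thesis using gt by (intro exI[of _ "B - A"]) auto
    qed
  qed
  have "bad UNIV" using nf by (simp add: bad_def less_top[symmetric])
  then have "\<exists>B. \<forall>n. bad (B n) \<and> (B (Suc n) \<subseteq> B n \<and> \<bar>\<mu> (B n - B (Suc n))\<bar> \<ge> 1)"
    by (intro dependent_nat_choice exI[of _ UNIV] step)
  then obtain B where B: "\<And>n. bad (B n)" "\<And>n. B (Suc n) \<subseteq> B n \<and> \<bar>\<mu> (B n - B (Suc n))\<bar> \<ge> 1"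
    by metis
  have anti: "B n \<subseteq> B m" if "m \<le> n" for m n
    using lift_Suc_antimono_le[of B] B(2) that by blast
  have "disjoint_family (\<lambda>n. B n - B (Suc n))"
    unfolding disjoint_family_on_def
  proof (intro ballI impI)
    fix m n :: nat assume "m \<noteq> n"
    then consider "Suc m \<le> n" | "Suc n \<le> m" by linarith
    then show "(B m - B (Suc m)) \<inter> (B n - B (Suc n)) = {}"
      using anti by cases blast+
  qed
  moreover have "range (\<lambda>n. B n - B (Suc n)) \<subseteq> sets borel"
    using B(1) by (auto simp: bad_def)
  ultimately have "summable (\<lambda>n. \<mu> (B n - B (Suc n)))"
    using L unfolding vector_measure_def by (meson sums_summable)
  then have "(\<lambda>n. \<mu> (B n - B (Suc n))) \<longlonglongrightarrow> 0"
    by (rule summable_LIMSEQ_zero)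
  from tendstoD[OF this, of 1] have "eventually (\<lambda>n. \<bar>\<mu> (B n - B (Suc n))\<bar> < 1) sequentially"
    by (simp add: dist_real_def)
  then obtain n where "\<bar>\<mu> (B n - B (Suc n))\<bar> < 1"
    using eventually_happens'[OF sequentially_bot] by blast
  then show False using B(2)[of n] by simp
qed

lemma vector_measure_bounded_linear:
  fixes D :: "'c::topological_space set \<Rightarrow> 'a::real_normed_vector"
  assumes "bounded_linear h" "vector_measure D"
  shows "vector_measure (\<lambda>A. h (D A))"
  unfolding vector_measure_def
proof (intro allI impI)
  fix E :: "nat \<Rightarrow> 'c set"
  assume "range E \<subseteq> sets borel" "disjoint_family E"
  then have "(\<lambda>i. D (E i)) sums D (\<Union>i. E i)"
    using assms(2) by (simp add: vector_measure_def)
  then show "(\<lambda>i. h (D (E i))) sums h (D (\<Union>i. E i))"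
    by (rule bounded_linear.sums[OF assms(1)])
qed

lemma vector_measure_uminus:
  "vector_measure \<mu> \<Longrightarrow> vector_measure (\<lambda>A. - \<mu> A)"
  using bounded_linear_minus[OF bounded_linear_ident]
  by (rule vector_measure_bounded_linear)

lemma finite_measure_positive_part:
  assumes "vector_measure \<mu>"
  shows "finite_measure (positive_part \<mu>)"
  using upper_variation_finite[OF assms]
  by (intro finite_measureI) (simp add: emeasure_positive_part[OF assms])

text \<open>For Borel \<open>A \<subseteq> B\<close>, additivity bounds
  \<open>\<mu> A = \<mu> B - \<mu> (B - A)\<close> by \<open>\<mu> B\<close> plus the negative part
  of \<open>B\<close>. The supremum over \<open>A\<close> gives one inequality, and the same
  argument for \<open>- \<mu>\<close> gives the other.\<close>

lemma jordan_decomposition: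
  assumes L: "vector_measure \<mu>" and B: "B \<in> sets borel"
  shows "\<mu> B = measure (positive_part \<mu>) B - measure (positive_part (\<lambda>A. - \<mu> A)) B"
proof -
  note L' = vector_measure_uminus[OF L]
  have half: "measure (positive_part \<nu>) B \<le> \<nu> B + measure (positive_part (\<lambda>A. - \<nu> A)) B"
    if V: "vector_measure \<nu>" for \<nu>
  proof -
    note V' = vector_measure_uminus[OF V]
    interpret V: finite_measure "positive_part \<nu>" by (rule finite_measure_positive_part[OF V])
    interpret V': finite_measure "positive_part (\<lambda>A. - \<nu> A)" by (rule finite_measure_positive_part[OF V'])
    let ?m = "measure (positive_part (\<lambda>A. - \<nu> A)) B"
    have *: "\<nu> A \<le> \<nu> B + ?m" if A: "A \<in> sets borel" "A \<subseteq> B" for A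
    proof -
      have "\<nu> (A \<union> (B - A)) = \<nu> A + \<nu> (B - A)"
        using A B by (intro vector_measure_Un[OF V]) auto
      moreover have "A \<union> (B - A) = B" using A by auto
      ultimately have eq: "\<nu> A = \<nu> B - \<nu> (B - A)" by simp
      have "ennreal (- \<nu> (B - A)) \<le> upper_variation (\<lambda>A. - \<nu> A) B"
        using A B unfolding upper_variation_def by (intro SUP_upper) auto
      also have "\<dots> = ennreal ?m"
        using emeasure_positive_part[OF V' B] V'.emeasure_eq_measure by metis
      finally have "- \<nu> (B - A) \<le> ?m" by (simp add: ennreal_le_iff)
      then show ?thesis using eq by simp
    qed
    have "0 \<le> \<nu> B + ?m" using *[of "{}"] vector_measure_empty[OF V] by simp
    have "ennreal (measure (positive_part \<nu>) B) = upper_variation \<nu> B"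
      using emeasure_positive_part[OF V B] V.emeasure_eq_measure by metis
    also have "\<dots> \<le> ennreal (\<nu> B + ?m)"
      unfolding upper_variation_def by (intro SUP_least ennreal_leI) (auto intro: *)
    finally show ?thesis using \<open>0 \<le> \<nu> B + ?m\<close> by (simp add: ennreal_le_iff)
  qed
  show ?thesis using half[OF L] half[OF L'] by simp
qed

text \<open>Dominated convergence, with the constant 1 as majorant, applies to the positive and the
  negative part because both are finite. The Jordan decomposition reassembles the two
  limits.\<close>

lemma signed_integral_tendsto_indicator:
  assumes L: "vector_measure \<mu>" and B: "B \<in> sets borel"
    and m: "\<And>k::nat. u k \<in> borel_measurable borel"
    and b: "\<And>k x. \<bar>u k x\<bar> \<le> 1"
    and lim: "\<And>x. (\<lambda>k. u k x) \<longlonglongrightarrow> indicator B x"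
  shows "(\<lambda>k. signed_integral \<mu> (u k)) \<longlonglongrightarrow> \<mu> B"
proof -
  have *: "(\<lambda>k. LINT x|positive_part \<nu>. u k x) \<longlonglongrightarrow> measure (positive_part \<nu>) B"
    if V: "vector_measure \<nu>" for \<nu>
  proof -
    interpret V: finite_measure "positive_part \<nu>" by (rule finite_measure_positive_part[OF V])
    have "(\<lambda>k. LINT x|positive_part \<nu>. u k x) \<longlonglongrightarrow> (LINT x|positive_part \<nu>. indicator B x)"
      using m B b lim by (intro integral_dominated_convergence[where w="\<lambda>_. 1"]) auto
    then show ?thesis using B by simp
  qed
  show ?thesis
    unfolding signed_integral_def jordan_decomposition[OF L B]
    using L by (intro tendsto_diff * vector_measure_uminus)
qed

section \<open>Variation and support\<close>

lemma ennreal_le_suminf: "h i \<le> (\<Sum>j. h j)" for h :: "nat \<Rightarrow> ennreal"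
  using sum_le_suminf[of h "{i}"] by (simp add: summableI)

text \<open>\<open>A\<close>, \<open>B - A\<close> and empty sets form a Borel partition of
  \<open>B\<close>, and its first term is at most the whole sum.\<close>

lemma norm_le_variation:
  assumes V: "vector_measure D" and "A \<in> sets borel" "B \<in> sets borel" "A \<subseteq> B"
  shows "ennreal (norm (D A)) \<le> variation D B"
proof -
  let ?E = "binaryset A (B - A)"
  have "?E \<in> {E. range E \<subseteq> sets borel \<and> disjoint_family E \<and> (\<Union>i. E i) = B}"
    using assms by (auto simp: disjoint_family_on_def UN_binaryset_eq) (auto simp: binaryset_def split: if_splits)
  then have "(\<Sum>i. ennreal (norm (D (?E i)))) \<le> variation D B"
    unfolding variation_def by (rule SUP_upper2) simp
  moreover have "ennreal (norm (D (?E 0))) \<le> (\<Sum>i. ennreal (norm (D (?E i))))"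
    by (rule ennreal_le_suminf)
  ultimately show ?thesis by (simp add: binaryset_def)
qed

text \<open>Each point off the support has an open neighbourhood of zero variation. By Lindelof,
  countably many of these cover \<open>B\<close>. Once their traces on \<open>B\<close> are made
  disjoint, \<open>D\<close> vanishes on every piece.\<close>

lemma vector_measure_zero_off_support:
  fixes D :: "'a::second_countable_topology set \<Rightarrow> 'b::real_normed_vector"
  assumes V: "vector_measure D" and B: "B \<in> sets borel" "B \<inter> variation_support D = {}"
  shows "D B = 0"
proof -
  define \<U> where "\<U> = {U. open U \<and> variation D U = 0}"
  have "\<And>U. U \<in> \<U> \<Longrightarrow> open U" by (simp add: \<U>_def)
  then obtain \<V> where \<V>: "\<V> \<subseteq> \<U>" "countable \<V>" "\<Union>\<V> = \<Union>\<U>"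
    using Lindelof[of \<U>] by metis
  have "B \<subseteq> \<Union>\<U>"
    using B(2) by (auto simp: variation_support_def \<U>_def zero_less_iff_neq_zero)
  show ?thesis
  \<comment> \<open>\<open>from_nat_into\<close> enumerates a nonempty family only; an empty cover
    forces \<open>B = {}\<close>.\<close>
  proof (cases "\<V> = {}")
    case True
    then have "\<Union>\<U> = {}" using \<V>(3) by (metis Union_empty)
    then have "B = {}" using \<open>B \<subseteq> \<Union>\<U>\<close> by (metis subset_empty)
    then show ?thesis using vector_measure_empty[OF V] by metis
  next
    case False
    define W where "W = from_nat_into \<V>"
    have W: "W i \<in> \<U>" for i
      using \<V>(1) from_nat_into[OF False] by (auto simp: W_def)
    have UW: "\<Union>\<U> = (\<Union>i. W i)"
      using \<V>(2,3) range_from_nat_into[OF False \<V>(2)] by (simp add: W_def)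
    let ?E = "disjointed (\<lambda>i. B \<inter> W i)"
    have meas: "W i \<in> sets borel" for i using W[of i] by (auto simp: \<U>_def)
    have rE: "range ?E \<subseteq> sets borel"
      using B meas by (intro sets.range_disjointed_sets) auto
    have "(\<Union>i. ?E i) = B"
      using \<open>B \<subseteq> \<Union>\<U>\<close> UW by (auto simp: UN_disjointed_eq)
    then have "(\<lambda>i. D (?E i)) sums D B"
      using V rE disjoint_family_disjointed[of "\<lambda>i. B \<inter> W i"] unfolding vector_measure_def by metis
    moreover have "D (?E i) = 0" for i
    proof -
      have "ennreal (norm (D (?E i))) \<le> variation D (W i)"
        using rE meas disjointed_subset[of "\<lambda>i. B \<inter> W i" i]
        by (intro norm_le_variation[OF V]) auto
      then show ?thesis using W[of i] by (simp add: \<U>_def)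
    qed
    ultimately show ?thesis
      by (simp add: sums_unique2[OF _ sums_zero])
  qed
qed

section \<open>The jump kernel\<close>

lemma nn_integral_lborel_affine:
  fixes f :: "'a::euclidean_space \<Rightarrow> ennreal"
  assumes f [measurable]: "f \<in> borel_measurable borel" and c: "c \<noteq> 0"
  shows "(\<integral>\<^sup>+x. f x \<partial>lborel) = (\<integral>\<^sup>+x. ennreal (\<bar>c\<bar> ^ DIM('a)) * f (t + c *\<^sub>R x) \<partial>lborel)"
  by (subst lborel_affine[OF c, of t]) (simp add: nn_integral_density nn_integral_distr)

text \<open>A majorant for increments of size at most \<open>min 1 (norm z / R)\<close> weighted by
  \<open>direction_kernel\<close>. The scale \<open>R\<close> is the width over which a cut-off
  varies: \<open>1 / c\<close> for the ramp, \<open>c\<close> for the tent.\<close>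

definition jump_kernel :: "real \<Rightarrow> real \<Rightarrow> 'a::euclidean_space \<Rightarrow> real" where
  "jump_kernel \<alpha> R z = min 1 (norm z / R) / norm z powr (real DIM('a) + \<alpha>)"

lemma jump_kernel_nonneg: "R > 0 \<Longrightarrow> jump_kernel \<alpha> R z \<ge> 0"
  by (simp add: jump_kernel_def)

lemma borel_measurable_jump_kernel [measurable]:
  "jump_kernel \<alpha> R \<in> borel_measurable borel"
  unfolding jump_kernel_def by measurable

lemma jump_kernel_scaling:
  assumes R: "R > 0"
  shows "jump_kernel \<alpha> R (R *\<^sub>R z) = R powr (- (real DIM('a) + \<alpha>)) * jump_kernel \<alpha> 1 (z::'a::euclidean_space)"
  using R by (simp add: jump_kernel_def powr_mult powr_minus_divide del: minus_add_distrib)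

lemma dyadic_below:
  fixes r :: real assumes "0 < r" "r < 1"
  obtains j :: nat where "r < (1/2)^j" "(1/2)^Suc j \<le> r"
proof -
  have "\<exists>j. (1/2)^j \<le> r"
    using real_arch_pow_inv[of r "1/2"] assms less_imp_le by auto
  define m where "m = (LEAST j. (1/2)^j \<le> r)"
  have m: "(1/2)^m \<le> r" unfolding m_def by (rule LeastI_ex) fact
  then have "m \<noteq> 0" using assms by (intro notI) auto
  then obtain j where j: "m = Suc j" using not0_implies_Suc by blast
  then have "\<not> (1/2)^j \<le> r" unfolding m_def using not_less_Least by (metis lessI m_def)
  with m j that show ?thesis by (auto simp: not_le)
qed

lemma dyadic_above:
  fixes r :: real assumes "1 \<le> r"
  obtains j :: nat where "2^j \<le> r" "r < 2^Suc j"
proof -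
  have "\<exists>j. r < 2^j" using real_arch_pow[of 2 r] by auto
  define m where "m = (LEAST j. r < 2^j)"
  have m: "r < 2^m" unfolding m_def by (rule LeastI_ex) fact
  then have "m \<noteq> 0" using assms by (intro notI) auto
  then obtain j where j: "m = Suc j" using not0_implies_Suc by blast
  then have "\<not> r < 2^j" unfolding m_def using not_less_Least by (metis lessI m_def)
  with m j that show ?thesis by (auto simp: not_less)
qed

text \<open>Summation over dyadic shells. Inside the unit ball the kernel is
  \<open>norm z powr (1 - n - \<alpha>)\<close> and the shells contribute a geometric series of
  ratio \<open>(1/2) powr (1 - \<alpha>)\<close>. Outside it is
  \<open>norm z powr (- (n + \<alpha>))\<close> and the ratio is \<open>2 powr (- \<alpha>)\<close>.
  Thus \<open>\<alpha> < 1\<close> gives convergence at the origin and \<open>0 < \<alpha>\<close>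
  at infinity.\<close>

lemma nn_integral_jump_kernel_finite:
  assumes a: "0 < \<alpha>" "\<alpha> < 1"
  shows "(\<integral>\<^sup>+z. ennreal (jump_kernel \<alpha> 1 (z::'a::euclidean_space)) \<partial>lborel) < \<infinity>"
proof -
  define n where "n = real DIM('a)"
  have n1: "n \<ge> 1" by (simp add: n_def Suc_leI)
  define v where "v = unit_ball_vol n"
  have v: "v \<ge> 0" by (simp add: v_def n_def)
  \<comment> \<open>\<open>A j\<close> and \<open>B j\<close> are the kernel's values at the inner
    radii \<open>(1/2)^Suc j\<close> and \<open>2^j\<close> of the shells, which are maximal there
    since the exponents are not positive.\<close>
  define A :: "nat \<Rightarrow> real" where "A j = (1/2) powr (real (Suc j) * (1 - n - \<alpha>))" for j
  define B :: "nat \<Rightarrow> real" where "B j = 2 powr (- real j * (n + \<alpha>))" for j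
  have volA: "emeasure lborel (ball (0::'a) ((1/2)^j)) = ennreal (v * (1/2) powr (real j * n))" for j
    by (subst emeasure_ball) (simp_all add: v_def n_def powr_realpow[symmetric] powr_powr)
  have volB: "emeasure lborel (ball (0::'a) (2^Suc j)) = ennreal (v * 2 powr (real (Suc j) * n))" for j
  proof -
    have "((2::real) ^ Suc j) ^ DIM('a) = 2 powr (real (Suc j) * n)"
      by (simp only: n_def power_mult[symmetric] of_nat_mult[symmetric] powr_realpow zero_less_numeral)
    then show ?thesis
      by (subst emeasure_ball) (simp_all add: v_def n_def)
  qed
  \<comment> \<open>Each shell is enlarged to the ball of its outer radius; the volumes stay
    geometric.\<close>
  define gA where "gA j z = ennreal (A j) * indicator (ball 0 ((1/2)^j)) z" for j and z :: 'a
  define gB where "gB j z = ennreal (B j) * indicator (ball 0 (2^Suc j)) z" for j and z :: 'a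
  have [measurable]: "gA j \<in> borel_measurable lborel" "gB j \<in> borel_measurable lborel" for j
    unfolding gA_def gB_def
    by (intro borel_measurable_times_ennreal borel_measurable_indicator; simp)+
  have pt: "ennreal (jump_kernel \<alpha> 1 z) \<le> (\<Sum>j. gA j z) + (\<Sum>j. gB j z)" for z :: 'a
  proof -
    consider "z = 0" | "0 < norm z" "norm z < 1" | "1 \<le> norm z" by fastforce
    then show ?thesis
    proof cases
      case 2
      then obtain j where j: "norm z < (1/2)^j" "(1/2)^Suc j \<le> norm z" by (rule dyadic_below)
      have "jump_kernel \<alpha> 1 z = norm z powr (1 - n - \<alpha>)"
        using 2 by (simp add: jump_kernel_def n_def powr_diff powr_add)
      also have "\<dots> \<le> ((1/2)^Suc j) powr (1 - n - \<alpha>)"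
        using 2 a n1 j(2) by (intro powr_mono2') auto
      also have "\<dots> = A j"
        unfolding A_def by (subst powr_realpow[symmetric]) (simp_all add: powr_powr)
      finally have "ennreal (jump_kernel \<alpha> 1 z) \<le> gA j z"
        using j by (simp add: gA_def ennreal_leI)
      also have "\<dots> \<le> (\<Sum>j. gA j z)" by (rule ennreal_le_suminf)
      also have "\<dots> \<le> (\<Sum>j. gA j z) + (\<Sum>j. gB j z)" by simp
      finally show ?thesis .
    next
      case 3
      then obtain j where j: "2^j \<le> norm z" "norm z < 2^Suc j" by (rule dyadic_above)
      have "jump_kernel \<alpha> 1 z = norm z powr (- (n + \<alpha>))"
        using 3 by (simp add: jump_kernel_def n_def powr_minus_divide del: minus_add_distrib)
      also have "\<dots> \<le> (2^j) powr (- (n + \<alpha>))"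
        using 3 a n1 j(1) by (intro powr_mono2') auto
      also have "\<dots> = B j"
        unfolding B_def by (subst powr_realpow[symmetric]) (simp_all add: powr_powr del: minus_add_distrib)
      finally have "ennreal (jump_kernel \<alpha> 1 z) \<le> gB j z"
        using j by (simp add: gB_def ennreal_leI)
      also have "\<dots> \<le> (\<Sum>j. gB j z)" by (rule ennreal_le_suminf)
      also have "\<dots> \<le> (\<Sum>j. gA j z) + (\<Sum>j. gB j z)" by simp
      finally show ?thesis .
    qed (simp add: jump_kernel_def)
  qed
  have fin: "(\<Sum>j. ennreal (c * q ^ j)) < \<infinity>" if "0 \<le> c" "0 \<le> q" "q < 1" for c q :: real
  proof -
    have "summable (\<lambda>j. c * q ^ j)" using that by (intro summable_mult summable_geometric) auto
    then have "(\<Sum>j. ennreal (c * q ^ j)) = ennreal (\<Sum>j. c * q ^ j)"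
      using that by (intro suminf_ennreal2) auto
    then show ?thesis by simp
  qed
  have powr_pow: "x powr (real j * y) = (x powr y) ^ j" if "x > 0" for x y :: real and j
    using that by (metis mult.commute powr_powr powr_realpow powr_gt_zero)
  have IA: "(\<integral>\<^sup>+z. gA j z \<partial>lborel) = ennreal (v * (1/2) powr (1 - n - \<alpha>) * ((1/2) powr (1 - \<alpha>)) ^ j)" for j
  proof -
    have "(\<integral>\<^sup>+z. gA j z \<partial>lborel) = ennreal (A j) * ennreal (v * (1/2) powr (real j * n))"
      unfolding gA_def by (subst nn_integral_cmult_indicator) (simp_all add: volA)
    also have "\<dots> = ennreal (v * (A j * (1/2) powr (real j * n)))"
      using v by (simp add: ennreal_mult'[symmetric] A_def mult_ac)
    also have "A j * (1/2) powr (real j * n) = (1/2) powr ((1 - n - \<alpha>) + real j * (1 - \<alpha>))"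
      unfolding A_def powr_add[symmetric] by (simp add: algebra_simps)
    also have "\<dots> = (1/2) powr (1 - n - \<alpha>) * ((1/2) powr (1 - \<alpha>)) ^ j"
      by (simp only: powr_add powr_pow)
    finally show ?thesis by (simp add: mult.assoc)
  qed
  have IB: "(\<integral>\<^sup>+z. gB j z \<partial>lborel) = ennreal (v * 2 powr n * (2 powr (- \<alpha>)) ^ j)" for j
  proof -
    have "(\<integral>\<^sup>+z. gB j z \<partial>lborel) = ennreal (B j) * ennreal (v * 2 powr (real (Suc j) * n))"
      unfolding gB_def by (subst nn_integral_cmult_indicator) (simp_all only: volB, simp_all)
    also have "\<dots> = ennreal (v * (B j * 2 powr (real (Suc j) * n)))"
      using v by (simp add: ennreal_mult'[symmetric] B_def mult_ac)
    also have "B j * 2 powr (real (Suc j) * n) = 2 powr (n + real j * (- \<alpha>))"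
      unfolding B_def powr_add[symmetric] by (simp add: algebra_simps)
    also have "\<dots> = 2 powr n * (2 powr (- \<alpha>)) ^ j"
      by (subst powr_add, subst powr_pow) simp_all
    finally show ?thesis by (simp add: mult.assoc)
  qed
  have q: "(1/2) powr (1 - \<alpha>) < (1::real)" "2 powr (- \<alpha>) < (1::real)"
    using a by (simp_all add: powr_less_one powr01_less_one)
  have "(\<integral>\<^sup>+z. ennreal (jump_kernel \<alpha> 1 (z::'a)) \<partial>lborel) \<le>
      (\<integral>\<^sup>+z. (\<Sum>j. gA j z) + (\<Sum>j. gB j z) \<partial>lborel)"
    by (intro nn_integral_mono pt)
  also have "\<dots> = (\<Sum>j. \<integral>\<^sup>+z. gA j z \<partial>lborel) + (\<Sum>j. \<integral>\<^sup>+z. gB j z \<partial>lborel)"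
    by (subst nn_integral_add) (simp_all add: nn_integral_suminf)
  also have "\<dots> < \<infinity>"
  proof -
    have "(\<Sum>j. \<integral>\<^sup>+z. gA j z \<partial>lborel) < \<infinity>"
      unfolding IA by (rule fin[OF _ _ q(1)]) (use v in auto)
    moreover have "(\<Sum>j. \<integral>\<^sup>+z. gB j z \<partial>lborel) < \<infinity>"
      unfolding IB by (rule fin[OF _ _ q(2)]) (use v in auto)
    ultimately show ?thesis by (metis ennreal_add_less_top infinity_ennreal_def)
  qed
  finally show ?thesis .
qed

text \<open>The substitution \<open>z = R *\<^sub>R w\<close> contributes the Jacobian
  \<open>R ^ DIM('a)\<close>, and the homogeneity in \<open>jump_kernel_scaling\<close> contributes
  \<open>R powr (- (DIM('a) + \<alpha>))\<close>. The constant \<open>K\<close> is the mass at scale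
  1.\<close>

lemma nn_integral_jump_kernel:
  assumes a: "0 < \<alpha>" "\<alpha> < 1"
  obtains K where "K \<ge> 0"
    "\<And>R. R > 0 \<Longrightarrow> (\<integral>\<^sup>+z. ennreal (jump_kernel \<alpha> R (z::'a::euclidean_space)) \<partial>lborel) = ennreal (R powr (- \<alpha>) * K)"
proof -
  let ?I = "\<integral>\<^sup>+z. ennreal (jump_kernel \<alpha> 1 (z::'a)) \<partial>lborel"
  define K where "K = enn2real ?I"
  have I: "?I = ennreal K"
    using nn_integral_jump_kernel_finite[OF a, where 'a='a] by (simp add: K_def)
  have "(\<integral>\<^sup>+z. ennreal (jump_kernel \<alpha> R (z::'a)) \<partial>lborel) = ennreal (R powr (- \<alpha>) * K)"
    if R: "R > 0" for R
  proof -
    have "(\<integral>\<^sup>+z. ennreal (jump_kernel \<alpha> R (z::'a)) \<partial>lborel) =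
        (\<integral>\<^sup>+z. ennreal (\<bar>R\<bar> ^ DIM('a)) * ennreal (jump_kernel \<alpha> R (0 + R *\<^sub>R (z::'a))) \<partial>lborel)"
      using R by (intro nn_integral_lborel_affine) auto
    also have "\<dots> = (\<integral>\<^sup>+z. ennreal (R powr (-\<alpha>)) * ennreal (jump_kernel \<alpha> 1 (z::'a)) \<partial>lborel)"
    proof (rule nn_integral_cong)
      fix z :: 'a
      have "R ^ DIM('a) * R powr (- (real DIM('a) + \<alpha>)) = R powr (-\<alpha>)"
        using R by (simp add: powr_realpow[symmetric] powr_add[symmetric])
      then show "ennreal (\<bar>R\<bar> ^ DIM('a)) * ennreal (jump_kernel \<alpha> R (0 + R *\<^sub>R z)) =
          ennreal (R powr (-\<alpha>)) * ennreal (jump_kernel \<alpha> 1 z)"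
        using R jump_kernel_nonneg[of 1 \<alpha> z] jump_kernel_scaling[OF R, of \<alpha> z]
        by (simp add: ennreal_mult'[symmetric] mult.assoc[symmetric] del: minus_add_distrib)
    qed
    also have "\<dots> = ennreal (R powr (-\<alpha>)) * ennreal K"
      by (simp add: nn_integral_cmult I)
    finally show ?thesis by (simp add: ennreal_mult'[symmetric])
  qed
  moreover have "K \<ge> 0" by (simp add: K_def)
  ultimately show ?thesis using that by blast
qed

section \<open>Weighted kernel bounds on the product space\<close>

text \<open>Tonelli, integrating first in \<open>y\<close>, and translation invariance.\<close>

lemma nn_integral_convolution_fst:
  fixes h \<kappa> :: "'a::euclidean_space \<Rightarrow> ennreal"
  assumes [measurable]: "h \<in> borel_measurable borel" "\<kappa> \<in> borel_measurable borel"
  shows "(\<integral>\<^sup>+z. h (fst z) * \<kappa> (snd z - fst z) \<partial>(lborel \<Otimes>\<^sub>M lborel)) =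
    (\<integral>\<^sup>+x. h x \<partial>lborel) * (\<integral>\<^sup>+z. \<kappa> z \<partial>lborel)"
proof -
  have "(\<integral>\<^sup>+y. \<kappa> (y - x) \<partial>lborel) = (\<integral>\<^sup>+z. \<kappa> z \<partial>lborel)" for x
    using nn_integral_lborel_affine[of \<kappa> 1 "-x"] by simp
  then have "(\<integral>\<^sup>+x. \<integral>\<^sup>+y. h (fst (x, y)) * \<kappa> (snd (x, y) - fst (x, y)) \<partial>lborel \<partial>lborel) =
      (\<integral>\<^sup>+x. h x \<partial>lborel) * (\<integral>\<^sup>+z. \<kappa> z \<partial>lborel)"
    by (simp add: nn_integral_cmult nn_integral_multc)
  moreover have "(\<integral>\<^sup>+x. \<integral>\<^sup>+y. h (fst (x, y)) * \<kappa> (snd (x, y) - fst (x, y)) \<partial>lborel \<partial>lborel) =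
      (\<integral>\<^sup>+z. h (fst z) * \<kappa> (snd z - fst z) \<partial>(lborel \<Otimes>\<^sub>M lborel))"
    by (rule lborel.nn_integral_fst) measurable
  ultimately show ?thesis by simp
qed

text \<open>Tonelli, integrating first in \<open>x\<close>; the map from \<open>x\<close> to
  \<open>y - x\<close> also reflects, hence the factor \<open>-1\<close> in the affine
  substitution.\<close>

lemma nn_integral_convolution_snd:
  fixes h \<kappa> :: "'a::euclidean_space \<Rightarrow> ennreal"
  assumes [measurable]: "h \<in> borel_measurable borel" "\<kappa> \<in> borel_measurable borel"
  shows "(\<integral>\<^sup>+z. h (snd z) * \<kappa> (snd z - fst z) \<partial>(lborel \<Otimes>\<^sub>M lborel)) =
    (\<integral>\<^sup>+x. h x \<partial>lborel) * (\<integral>\<^sup>+z. \<kappa> z \<partial>lborel)"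
proof -
  have "(\<integral>\<^sup>+x. \<kappa> (y - x) \<partial>lborel) = (\<integral>\<^sup>+z. \<kappa> z \<partial>lborel)" for y
    using nn_integral_lborel_affine[of \<kappa> "-1" y] by simp
  then have "(\<integral>\<^sup>+y. \<integral>\<^sup>+x. h y * \<kappa> (y - x) \<partial>lborel \<partial>lborel) =
      (\<integral>\<^sup>+x. h x \<partial>lborel) * (\<integral>\<^sup>+z. \<kappa> z \<partial>lborel)"
    by (simp add: nn_integral_cmult nn_integral_multc)
  moreover have "(\<integral>\<^sup>+y. \<integral>\<^sup>+x. h y * \<kappa> (y - x) \<partial>lborel \<partial>lborel) =
      (\<integral>\<^sup>+z. h (snd z) * \<kappa> (snd z - fst z) \<partial>(lborel \<Otimes>\<^sub>M lborel))"
    using lborel_pair.nn_integral_snd[of "\<lambda>z. h (snd z) * \<kappa> (snd z - fst z)"] by simp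
  ultimately show ?thesis by simp
qed

text \<open>Above the threshold, \<open>u powr (1 - q) \<le> T powr (1 - q)\<close> because the
  exponent is not positive.\<close>

lemma le_threshold_plus_powr:
  fixes u :: real
  assumes "u \<ge> 0" "T > 0" "q \<ge> 1"
  shows "u \<le> T + T powr (1 - q) * u powr q"
proof (cases "u \<le> T")
  case True
  then show ?thesis by (simp add: add_increasing2)
next
  case False
  have "u = u powr (1 - q) * u powr q"
    using False assms by (simp add: powr_add[symmetric])
  also have "\<dots> \<le> T powr (1 - q) * u powr q"
    using False assms by (intro mult_right_mono powr_mono2') auto
  finally show ?thesis using assms by simp
qed

text \<open>Replaces Hoelder's inequality: the threshold \<open>T\<close> is free and absorbs the exponents.\<close>

lemma nn_integral_weighted_kernel_le:
  fixes f \<kappa> :: "'a::euclidean_space \<Rightarrow> real" and g :: "'a \<times> 'a \<Rightarrow> real"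
  assumes [measurable]: "f \<in> borel_measurable borel" "\<kappa> \<in> borel_measurable borel" "B \<in> sets borel"
    and f0: "\<And>x. f x \<ge> 0" and k0: "\<And>z. \<kappa> z \<ge> 0" "k \<ge> 0"
    and T: "T > 0" and q: "q \<ge> 1" and b: "b \<ge> 0"
    and fint: "integrable lborel (\<lambda>x. f x powr q)"
    and kint: "(\<integral>\<^sup>+z. \<kappa> z \<partial>lborel) = ennreal k"
    and vol: "emeasure lborel B = ennreal b"
    and g1: "\<And>x y. \<bar>g (x, y)\<bar> \<le> \<kappa> (y - x)"
    and g2: "\<And>x y. x \<notin> B \<Longrightarrow> y \<notin> B \<Longrightarrow> g (x, y) = 0"
  shows "(\<integral>\<^sup>+z. ennreal (norm (f (fst z) * g z)) \<partial>(lborel \<Otimes>\<^sub>M lborel)) \<le>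
    ennreal (2 * T * b * k + T powr (1 - q) * (LINT x|lborel. f x powr q) * k)"
proof -
  let ?M = "lborel \<Otimes>\<^sub>M lborel :: ('a \<times> 'a) measure"
  let ?\<kappa> = "\<lambda>z. ennreal (\<kappa> z)"
  let ?a = "\<lambda>z. ennreal T * (indicator B (fst z) * ?\<kappa> (snd z - fst z))"
  let ?b = "\<lambda>z. ennreal T * (indicator B (snd z) * ?\<kappa> (snd z - fst z))"
  let ?c = "\<lambda>z. ennreal (T powr (1 - q)) * (ennreal (f (fst z) powr q) * ?\<kappa> (snd z - fst z))"
  \<comment> \<open>\<open>f\<close> is split at height \<open>T\<close>. As \<open>g\<close>
    vanishes when both points are outside \<open>B\<close>, the constant \<open>T\<close> is charged
    only to pairs with \<open>x\<close> or \<open>y\<close> in \<open>B\<close>, by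
    \<open>?a\<close> and \<open>?b\<close>; this is the factor 2 in the bound. The term
    \<open>?c\<close> carries the \<open>q\<close>-th power of \<open>f\<close>.\<close>
  have pt: "ennreal (norm (f x * g (x, y))) \<le> ?a (x, y) + ?b (x, y) + ?c (x, y)" for x y
  proof (cases "x \<in> B \<or> y \<in> B")
    case True
    let ?i = "indicator B x + indicator B y :: real"
    have "norm (f x * g (x, y)) \<le> (T + T powr (1 - q) * f x powr q) * \<kappa> (y - x)"
      unfolding real_norm_def abs_mult using le_threshold_plus_powr[OF f0[of x] T q] f0[of x] g1 T
      by (intro mult_mono) auto
    also have "\<dots> = T * 1 * \<kappa> (y - x) + T powr (1 - q) * f x powr q * \<kappa> (y - x)"
      by (simp add: algebra_simps)
    also have "\<dots> \<le> T * ?i * \<kappa> (y - x) + T powr (1 - q) * f x powr q * \<kappa> (y - x)"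
      using True T k0 by (intro add_right_mono mult_right_mono mult_left_mono) (auto simp: indicator_def)
    finally have "ennreal (norm (f x * g (x, y))) \<le>
        ennreal (T * (indicator B x * \<kappa> (y - x)) + T * (indicator B y * \<kappa> (y - x)) +
          T powr (1 - q) * (f x powr q * \<kappa> (y - x)))"
      by (intro ennreal_leI) (simp add: algebra_simps)
    also have "\<dots> = ?a (x, y) + ?b (x, y) + ?c (x, y)"
      using T k0 by (simp add: ennreal_plus ennreal_mult' ennreal_indicator)
    finally show ?thesis .
  qed (simp add: g2)
  have "(\<integral>\<^sup>+z. ennreal (norm (f (fst z) * g z)) \<partial>?M) \<le> (\<integral>\<^sup>+z. ?a z + ?b z + ?c z \<partial>?M)"
    using pt by (intro nn_integral_mono) (auto simp: split_paired_all)
  also have "\<dots> = (\<integral>\<^sup>+z. ?a z \<partial>?M) + (\<integral>\<^sup>+z. ?b z \<partial>?M) + (\<integral>\<^sup>+z. ?c z \<partial>?M)"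
    by (subst nn_integral_add; (subst nn_integral_add)?) measurable
  also have "(\<integral>\<^sup>+z. ?a z \<partial>?M) = ennreal T * (ennreal b * ennreal k)"
    by (subst nn_integral_cmult, measurable, subst nn_integral_convolution_fst) (auto simp: kint vol)
  also have "(\<integral>\<^sup>+z. ?b z \<partial>?M) = ennreal T * (ennreal b * ennreal k)"
    by (subst nn_integral_cmult, measurable, subst nn_integral_convolution_snd) (auto simp: kint vol)
  also have "(\<integral>\<^sup>+z. ?c z \<partial>?M) =
      ennreal (T powr (1 - q)) * (ennreal (LINT x|lborel. f x powr q) * ennreal k)"
    using nn_integral_eq_integral[OF fint]
    by (subst nn_integral_cmult, measurable, subst nn_integral_convolution_fst) (auto simp: kint)
  also have "ennreal T * (ennreal b * ennreal k) + ennreal T * (ennreal b * ennreal k) + \<dots> =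
      ennreal (2 * T * b * k + T powr (1 - q) * (LINT x|lborel. f x powr q) * k)"
    using T b k0 by (simp add: ennreal_mult'[symmetric] ennreal_plus[symmetric] mult.assoc del: ennreal_plus)
  finally show ?thesis .
qed

section \<open>Passage from Lebesgue to Borel integrals\<close>

lemma frac_const_pos:
  assumes "\<alpha> < 1" "0 < \<alpha>" shows "frac_const n \<alpha> > 0"
  using assms by (auto simp: frac_const_def intro!: mult_pos_pos divide_pos_pos Gamma_real_pos)

lemma frac_div_lborel:
  fixes \<phi> :: "'a::euclidean_space \<Rightarrow> 'a"
  assumes [measurable]: "\<phi> \<in> borel_measurable borel"
  shows "frac_div \<alpha> \<phi> x = frac_const DIM('a) \<alpha> *
     (LINT y|lborel. ((y - x) \<bullet> (\<phi> y - \<phi> x)) / norm (y - x) powr (real DIM('a) + \<alpha> + 1))"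
  unfolding frac_div_def by (subst integral_completion) auto

lemma borel_measurable_frac_div:
  fixes \<phi> :: "'a::euclidean_space \<Rightarrow> 'a"
  assumes [measurable]: "\<phi> \<in> borel_measurable borel"
  shows "frac_div \<alpha> \<phi> \<in> borel_measurable borel"
proof -
  have "(\<lambda>x. LINT y|lborel. ((y - x) \<bullet> (\<phi> y - \<phi> x)) / norm (y - x) powr (real DIM('a) + \<alpha> + 1))
      \<in> borel_measurable (borel :: 'a measure)"
    by (rule lborel.borel_measurable_lebesgue_integral) measurable
  then show ?thesis
    by (simp add: frac_div_lborel[OF assms] cong: measurable_cong)
qed

lemma AE_lborel_not_open:
  fixes U :: "'a::euclidean_space set"
  assumes "AE x in lborel. x \<notin> U" "open U"
  shows "U = {}"
proof (rule ccontr)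
  assume "U \<noteq> {}"
  have "U \<in> null_sets lborel"
    using assms AE_iff_null_sets[of U lborel] by auto
  then have "negligible U"
    by (simp add: negligible_iff_null_sets null_sets_completionI)
  then show False using open_not_negligible[OF assms(2) \<open>U \<noteq> {}\<close>] by simp
qed

section \<open>Cut-off half-spaces\<close>

definition ramp :: "'a::euclidean_space \<Rightarrow> 'a \<Rightarrow> real \<Rightarrow> 'a \<Rightarrow> real" where
  "ramp \<nu> x0 c x = min 1 (max 0 (c * ((x - x0) \<bullet> \<nu>)))"

definition tent :: "'a::euclidean_space \<Rightarrow> real \<Rightarrow> 'a \<Rightarrow> real" where
  "tent x0 c x = max 0 (1 - norm (x - x0) / c)"

lemma borel_measurable_ramp [measurable]: "ramp \<nu> x0 c \<in> borel_measurable borel"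
  unfolding ramp_def by measurable

lemma borel_measurable_tent [measurable]: "tent x0 c \<in> borel_measurable borel"
  unfolding tent_def by measurable

lemma ramp_bounds: "0 \<le> ramp \<nu> x0 c x" "ramp \<nu> x0 c x \<le> 1"
  by (auto simp: ramp_def)

lemma tent_bounds: "c > 0 \<Longrightarrow> 0 \<le> tent x0 c x" "c > 0 \<Longrightarrow> tent x0 c x \<le> 1"
  by (auto simp: tent_def)

lemma tent_eq_0: "c > 0 \<Longrightarrow> x \<notin> ball x0 c \<Longrightarrow> tent x0 c x = 0"
  by (auto simp: tent_def dist_norm norm_minus_commute)

text \<open>The right side is written with \<open>1 / c\<close> to match \<open>jump_kernel\<close>
  at scale \<open>R = 1 / c\<close>.\<close>

lemma ramp_diff_le:
  assumes "norm \<nu> = 1" "c > 0"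
  shows "\<bar>ramp \<nu> x0 c y - ramp \<nu> x0 c x\<bar> \<le> min 1 (norm (y - x) / (1 / c))"
proof -
  have "\<bar>ramp \<nu> x0 c y - ramp \<nu> x0 c x\<bar> \<le> \<bar>c * ((y - x0) \<bullet> \<nu>) - c * ((x - x0) \<bullet> \<nu>)\<bar>"
    unfolding ramp_def by (auto simp: min_def max_def)
  also have "\<dots> = c * \<bar>(y - x) \<bullet> \<nu>\<bar>"
    using assms by (simp add: abs_mult right_diff_distrib[symmetric] inner_diff_left[symmetric])
  also have "\<dots> \<le> c * norm (y - x)"
    using Cauchy_Schwarz_ineq2[of "y - x" \<nu>] assms by (intro mult_left_mono) auto
  finally show ?thesis
    using ramp_bounds[of \<nu> x0 c x] ramp_bounds[of \<nu> x0 c y] by (simp add: mult.commute abs_le_iff)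
qed

lemma tent_diff_le:
  assumes "c > 0"
  shows "\<bar>tent x0 c y - tent x0 c x\<bar> \<le> min 1 (norm (y - x) / c)"
proof -
  have "\<bar>tent x0 c y - tent x0 c x\<bar> \<le> \<bar>norm (y - x0) / c - norm (x - x0) / c\<bar>"
    unfolding tent_def by (auto simp: max_def)
  also have "\<dots> \<le> norm (y - x) / c"
    using norm_triangle_ineq3[of "y - x0" "x - x0"] assms
    by (simp add: diff_divide_distrib[symmetric] divide_right_mono)
  finally show ?thesis
    using tent_bounds[OF assms, of x0 x] tent_bounds[OF assms, of x0 y] by (simp add: abs_le_iff)
qed

lemma ramp_mono_direction:
  assumes "c > 0"
  shows "0 \<le> (ramp \<nu> x0 c y - ramp \<nu> x0 c x) * ((y - x) \<bullet> \<nu>)"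
proof -
  have eq: "(y - x) \<bullet> \<nu> = (y - x0) \<bullet> \<nu> - (x - x0) \<bullet> \<nu>"
    by (simp add: inner_diff_left)
  have mono: "min 1 (max 0 (c * s)) \<le> min 1 (max 0 (c * t))" if "s \<le> t" for s t
    using assms that by (intro min.mono max.mono mult_left_mono) auto
  show ?thesis
    unfolding ramp_def eq
    using mono[of "(x - x0) \<bullet> \<nu>" "(y - x0) \<bullet> \<nu>"] mono[of "(y - x0) \<bullet> \<nu>" "(x - x0) \<bullet> \<nu>"]
    by (cases "(x - x0) \<bullet> \<nu> \<le> (y - x0) \<bullet> \<nu>") (auto intro: mult_nonneg_nonneg mult_nonpos_nonpos)
qed

text \<open>The ramp is eventually 1 inside the open half-space and always 0 elsewhere, so the limit
  excludes the boundary hyperplane. \<open>Suc k\<close> keeps the slope positive.\<close>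

lemma ramp_tendsto:
  "(\<lambda>k. ramp \<nu> x0 (real (Suc k)) x) \<longlonglongrightarrow> indicator (halfspace \<nu> x0) x"
proof (cases "(x - x0) \<bullet> \<nu> > 0")
  case True
  then obtain m :: nat where m: "1 < real m * ((x - x0) \<bullet> \<nu>)"
    using reals_Archimedean3 by blast
  have "ramp \<nu> x0 (real (Suc k)) x = 1" if "k \<ge> m" for k
  proof -
    have "real m * ((x - x0) \<bullet> \<nu>) \<le> real (Suc k) * ((x - x0) \<bullet> \<nu>)"
      using True that by (intro mult_right_mono) auto
    then show ?thesis unfolding ramp_def using m by linarith
  qed
  then have "eventually (\<lambda>k. ramp \<nu> x0 (real (Suc k)) x = 1) sequentially"
    unfolding eventually_sequentially by blast
  then show ?thesis
    using True by (simp add: halfspace_def tendsto_eventually)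
next
  case False
  then have "ramp \<nu> x0 (real (Suc k)) x = 0" for k
    using mult_nonneg_nonpos[of "real (Suc k)" "(x - x0) \<bullet> \<nu>"] by (simp add: ramp_def)
  then show ?thesis
    using False by (simp add: halfspace_def)
qed

lemma tent_tendsto: "(\<lambda>k. tent x0 (real (Suc k)) x) \<longlonglongrightarrow> 1"
proof -
  have "(\<lambda>k. norm (x - x0) / real (Suc k)) \<longlonglongrightarrow> 0"
    by (rule LIMSEQ_Suc[OF lim_const_over_n])
  then have "(\<lambda>k. max 0 (1 - norm (x - x0) / real (Suc k))) \<longlonglongrightarrow> max 0 (1 - 0)"
    by (intro tendsto_intros)
  then show ?thesis by (simp add: tent_def)
qed

section \<open>The cut-off test field\<close>

text \<open>The same \<open>c\<close> is the slope of the ramp and the radius of the tent, so a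
  single limit sharpens the ramp and exhausts the space.\<close>

definition cutoff :: "'a::euclidean_space \<Rightarrow> 'a \<Rightarrow> real \<Rightarrow> 'a \<Rightarrow> 'a" where
  "cutoff \<nu> x0 c x = (ramp \<nu> x0 c x * tent x0 c x) *\<^sub>R \<nu>"

lemma borel_measurable_cutoff [measurable]: "cutoff \<nu> x0 c \<in> borel_measurable borel"
  unfolding cutoff_def by measurable

lemma cutoff_Lip_c:
  assumes n: "norm \<nu> = 1" and c: "c > 0"
  shows "cutoff \<nu> x0 c \<in> Lip_c"
proof -
  have "(c + 1 / c)-lipschitz_on UNIV (cutoff \<nu> x0 c)"
  proof (rule lipschitz_onI)
    fix x y :: 'a
    have "dist (cutoff \<nu> x0 c x) (cutoff \<nu> x0 c y) =
        \<bar>ramp \<nu> x0 c x * tent x0 c x - ramp \<nu> x0 c y * tent x0 c y\<bar>"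
      using n by (simp add: cutoff_def dist_norm scaleR_diff_left[symmetric])
    also have "\<dots> = \<bar>(ramp \<nu> x0 c x - ramp \<nu> x0 c y) * tent x0 c x +
        ramp \<nu> x0 c y * (tent x0 c x - tent x0 c y)\<bar>"
      by (simp add: algebra_simps)
    also have "\<dots> \<le> \<bar>ramp \<nu> x0 c x - ramp \<nu> x0 c y\<bar> * tent x0 c x +
        ramp \<nu> x0 c y * \<bar>tent x0 c x - tent x0 c y\<bar>"
      using ramp_bounds[of \<nu> x0 c y] tent_bounds[OF c, of x0 x]
      by (intro order_trans[OF abs_triangle_ineq]) (simp add: abs_mult)
    also have "\<dots> \<le> (c * norm (x - y)) * 1 + 1 * (norm (x - y) / c)"
      using ramp_bounds[of \<nu> x0 c y] tent_bounds[OF c, of x0 x] c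
        ramp_diff_le[OF n c, of x0 x y] tent_diff_le[OF c, of x0 x y]
      by (intro add_mono mult_mono) (auto simp: mult.commute)
    finally show "dist (cutoff \<nu> x0 c x) (cutoff \<nu> x0 c y) \<le> (c + 1 / c) * dist x y"
      by (simp add: dist_norm algebra_simps)
  qed (use c in simp)
  moreover have "{x. cutoff \<nu> x0 c x \<noteq> 0} \<subseteq> ball x0 c"
    using tent_eq_0[OF c] by (force simp: cutoff_def)
  then have "compact (closure {x. cutoff \<nu> x0 c x \<noteq> 0})"
    by (meson bounded_ball bounded_subset compact_closure)
  ultimately show ?thesis
    by (auto simp: Lip_c_def compactly_supported_def)
qed

text \<open>Every coordinate of the field is a constant multiple of one scalar cut-off, bounded by 1
  and converging to the indicator of the half-space, so the limit can be taken
  coordinatewise.\<close>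

lemma vector_integral_cutoff_tendsto:
  fixes D :: "'a::euclidean_space set \<Rightarrow> 'a"
  assumes V: "vector_measure D"
  shows "(\<lambda>k. vector_integral D (cutoff \<nu> x0 (real (Suc k)))) \<longlonglongrightarrow> \<nu> \<bullet> D (halfspace \<nu> x0)"
proof -
  let ?H = "halfspace \<nu> x0"
  let ?u = "\<lambda>k x. ramp \<nu> x0 (real (Suc k)) x * tent x0 (real (Suc k)) x"
  have H: "?H \<in> sets borel" unfolding halfspace_def by measurable
  have "(\<lambda>k. signed_integral (\<lambda>A. D A \<bullet> b) (?u k)) \<longlonglongrightarrow> D ?H \<bullet> b" for b
  proof (rule signed_integral_tendsto_indicator)
    show "vector_measure (\<lambda>A. D A \<bullet> b)"
      by (rule vector_measure_bounded_linear[OF bounded_linear_inner_left V])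
    show "\<bar>?u k x\<bar> \<le> 1" for k x
      using ramp_bounds[of \<nu> x0 "real (Suc k)" x] tent_bounds[of "real (Suc k)" x0 x]
      by (simp add: abs_mult mult_le_one)
    show "(\<lambda>k. ?u k x) \<longlonglongrightarrow> indicator ?H x" for x
      using tendsto_mult[OF ramp_tendsto[of \<nu> x0 x] tent_tendsto[of x0 x]] by simp
  qed (use H in measurable)
  then have "(\<lambda>k. \<Sum>b\<in>Basis. (\<nu> \<bullet> b) * signed_integral (\<lambda>A. D A \<bullet> b) (?u k)) \<longlonglongrightarrow>
      (\<Sum>b\<in>Basis. (\<nu> \<bullet> b) * (D ?H \<bullet> b))"
    by (intro tendsto_sum tendsto_mult_left)
  moreover have "vector_integral D (cutoff \<nu> x0 (real (Suc k))) =
      (\<Sum>b\<in>Basis. (\<nu> \<bullet> b) * signed_integral (\<lambda>A. D A \<bullet> b) (?u k))" for k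
    unfolding vector_integral_def signed_integral_def cutoff_def inner_scaleR_left
    by (simp add: algebra_simps)
  ultimately show ?thesis by (subst euclidean_inner) simp
qed

text \<open>The integrand of \<open>frac_div \<alpha> (cutoff \<nu> x0 c)\<close> is \<open>transport + cutoff_error\<close>; the
  first is nonnegative because the ramp increases in direction \<open>\<nu>\<close>.\<close>

definition direction_kernel :: "real \<Rightarrow> 'a::euclidean_space \<Rightarrow> 'a \<Rightarrow> real" where
  "direction_kernel \<alpha> \<nu> z = (z \<bullet> \<nu>) / norm z powr (real DIM('a) + \<alpha> + 1)"

definition transport :: "real \<Rightarrow> 'a::euclidean_space \<Rightarrow> 'a \<Rightarrow> real \<Rightarrow> 'a \<times> 'a \<Rightarrow> real" where
  "transport \<alpha> \<nu> x0 c = (\<lambda>(x, y).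
    (ramp \<nu> x0 c y - ramp \<nu> x0 c x) * tent x0 c y * direction_kernel \<alpha> \<nu> (y - x))"

definition cutoff_error :: "real \<Rightarrow> 'a::euclidean_space \<Rightarrow> 'a \<Rightarrow> real \<Rightarrow> 'a \<times> 'a \<Rightarrow> real" where
  "cutoff_error \<alpha> \<nu> x0 c = (\<lambda>(x, y).
    ramp \<nu> x0 c x * (tent x0 c y - tent x0 c x) * direction_kernel \<alpha> \<nu> (y - x))"

section \<open>Bounds and limits for the two parts of the integrand\<close>

lemma borel_measurable_direction_kernel [measurable]:
  "direction_kernel \<alpha> \<nu> \<in> borel_measurable borel"
  unfolding direction_kernel_def by measurable

lemma borel_measurable_transport [measurable]:
  "transport \<alpha> \<nu> x0 c \<in> borel_measurable (lborel \<Otimes>\<^sub>M lborel)"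
  unfolding transport_def by measurable

lemma borel_measurable_cutoff_error [measurable]:
  "cutoff_error \<alpha> \<nu> x0 c \<in> borel_measurable (lborel \<Otimes>\<^sub>M lborel)"
  unfolding cutoff_error_def by measurable

text \<open>Cauchy-Schwarz cancels one power of \<open>norm z\<close>. At \<open>z = 0\<close> both
  sides are 0 by the convention for division by zero.\<close>

lemma direction_kernel_le:
  fixes z :: "'a::euclidean_space"
  assumes "norm \<nu> = 1" "R > 0" "\<bar>u\<bar> \<le> min 1 (norm z / R)"
  shows "\<bar>u * direction_kernel \<alpha> \<nu> z\<bar> \<le> jump_kernel \<alpha> R z"
proof (cases "z = 0")
  case False
  have "\<bar>direction_kernel \<alpha> \<nu> z\<bar> \<le> norm z / norm z powr (real DIM('a) + \<alpha> + 1)"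
    unfolding direction_kernel_def using Cauchy_Schwarz_ineq2[of z \<nu>] assms
    by (simp add: divide_right_mono)
  also have "\<dots> = 1 / norm z powr (real DIM('a) + \<alpha>)"
    using False by (simp add: powr_add)
  finally have "\<bar>u\<bar> * \<bar>direction_kernel \<alpha> \<nu> z\<bar> \<le>
      min 1 (norm z / R) * (1 / norm z powr (real DIM('a) + \<alpha>))"
    using assms by (intro mult_mono) auto
  then show ?thesis by (simp add: abs_mult jump_kernel_def)
qed (simp add: direction_kernel_def jump_kernel_def)

lemma transport_nonneg:
  assumes "c > 0" shows "0 \<le> transport \<alpha> \<nu> x0 c z"
proof (cases z)
  case (Pair x y)
  have "transport \<alpha> \<nu> x0 c (x, y) = (ramp \<nu> x0 c y - ramp \<nu> x0 c x) * ((y - x) \<bullet> \<nu>) *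
      (tent x0 c y / norm (y - x) powr (real DIM('a) + \<alpha> + 1))"
    by (simp add: transport_def direction_kernel_def)
  also have "\<dots> \<ge> 0"
    using assms by (intro mult_nonneg_nonneg ramp_mono_direction divide_nonneg_nonneg tent_bounds) auto
  finally show ?thesis using Pair by simp
qed

lemma transport_le:
  assumes "norm \<nu> = 1" "c > 0"
  shows "\<bar>transport \<alpha> \<nu> x0 c (x, y)\<bar> \<le> jump_kernel \<alpha> (1 / c) (y - x)"
proof -
  have "\<bar>(ramp \<nu> x0 c y - ramp \<nu> x0 c x) * tent x0 c y\<bar> \<le> min 1 (norm (y - x) / (1 / c)) * 1"
    unfolding abs_mult using assms tent_bounds[of c x0 y]
    by (intro mult_mono ramp_diff_le) auto
  then show ?thesis
    using assms by (simp add: transport_def direction_kernel_le del: divide_divide_eq_right)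
qed

text \<open>Only the tent is differenced, so the scale is \<open>c\<close>, and the mass of the
  majorant decays like \<open>c powr (- \<alpha>)\<close>.\<close>

lemma cutoff_error_le:
  assumes "norm \<nu> = 1" "c > 0"
  shows "\<bar>cutoff_error \<alpha> \<nu> x0 c (x, y)\<bar> \<le> jump_kernel \<alpha> c (y - x)"
proof -
  have "\<bar>ramp \<nu> x0 c x * (tent x0 c y - tent x0 c x)\<bar> \<le> 1 * min 1 (norm (y - x) / c)"
    unfolding abs_mult using assms ramp_bounds[of \<nu> x0 c x]
    by (intro mult_mono tent_diff_le) auto
  then show ?thesis
    using assms by (simp add: cutoff_error_def direction_kernel_le)
qed

lemma transport_tendsto:
  "(\<lambda>k. transport \<alpha> \<nu> x0 (real (Suc k)) (x, y)) \<longlonglongrightarrow>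
    (indicator (halfspace \<nu> x0) y - indicator (halfspace \<nu> x0) x) * direction_kernel \<alpha> \<nu> (y - x)"
proof -
  have "(\<lambda>k. transport \<alpha> \<nu> x0 (real (Suc k)) (x, y)) \<longlonglongrightarrow>
    (indicator (halfspace \<nu> x0) y - indicator (halfspace \<nu> x0) x) * 1 * direction_kernel \<alpha> \<nu> (y - x)"
    unfolding transport_def prod.case
    by (intro tendsto_mult tendsto_diff ramp_tendsto tent_tendsto tendsto_const)
  then show ?thesis by simp
qed

lemma frac_div_cutoff:
  fixes x :: "'a::euclidean_space"
  shows "frac_div \<alpha> (cutoff \<nu> x0 c) x = frac_const DIM('a) \<alpha> *
    (LINT y|lborel. transport \<alpha> \<nu> x0 c (x, y) + cutoff_error \<alpha> \<nu> x0 c (x, y))"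
proof -
  have "((y - x) \<bullet> (cutoff \<nu> x0 c y - cutoff \<nu> x0 c x)) / norm (y - x) powr (real DIM('a) + \<alpha> + 1) =
      transport \<alpha> \<nu> x0 c (x, y) + cutoff_error \<alpha> \<nu> x0 c (x, y)" for y
  proof -
    have "d \<bullet> (a *\<^sub>R \<nu> - b *\<^sub>R \<nu>) / N = (a - b) * (d \<bullet> \<nu> / N)" for a b N and d :: 'a
      by (simp add: inner_diff_right left_diff_distrib diff_divide_distrib)
    moreover have "(ry * ty - rx * tx) * K = (ry - rx) * ty * K + rx * (ty - tx) * K"
      for rx ry tx ty K :: real
      by (simp add: algebra_simps)
    ultimately show ?thesis
      unfolding transport_def cutoff_error_def direction_kernel_def prod.case cutoff_def by metis
  qed
  then show ?thesis by (simp add: frac_div_lborel)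
qed

section \<open>Vanishing\<close>

text \<open>The core of the argument, set over \<open>lborel\<close> with a Borel \<open>f\<close>
  that is nonnegative everywhere, so that Fubini and Fatou apply on the product space.\<close>

lemma halfspace_zero_imp_AE_zero:
  fixes f :: "'a::euclidean_space \<Rightarrow> real" and D :: "'a set \<Rightarrow> 'a" and \<alpha> q :: real
  assumes a: "0 < \<alpha>" "\<alpha> < 1" and q: "1 \<le> q" "q * (DIM('a) - \<alpha>) < DIM('a)"
    and f [measurable]: "f \<in> borel_measurable borel" and f0: "\<And>x. 0 \<le> f x"
    and fint: "integrable lborel (\<lambda>x. f x powr q)"
    and V: "vector_measure D"
    and ibp: "\<And>\<phi>. \<phi> \<in> Lip_c \<Longrightarrow> \<phi> \<in> borel_measurable borel \<Longrightarrow>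
      (LINT x|lborel. f x * frac_div \<alpha> \<phi> x) = - vector_integral D \<phi>"
    and \<nu>: "norm \<nu> = 1" and H: "D (halfspace \<nu> x0) = 0"
  shows "AE x in lborel. f x = 0"
proof -
  let ?M = "lborel \<Otimes>\<^sub>M lborel :: ('a \<times> 'a) measure"
  define n where "n = real DIM('a)"
  define c where "c k = real (Suc k)" for k
  have c: "c k > 0" for k by (simp add: c_def)
  define P where "P k z = f (fst z) * transport \<alpha> \<nu> x0 (c k) z" for k z
  define E where "E k z = f (fst z) * cutoff_error \<alpha> \<nu> x0 (c k) z" for k z
  have [measurable]: "P k \<in> borel_measurable ?M" "E k \<in> borel_measurable ?M" for k
    unfolding P_def E_def by measurable
  obtain K where K: "K \<ge> 0" "\<And>R. R > 0 \<Longrightarrow>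
      (\<integral>\<^sup>+z. ennreal (jump_kernel \<alpha> R (z::'a)) \<partial>lborel) = ennreal (R powr (- \<alpha>) * K)"
    using nn_integral_jump_kernel[OF a] by metis
  define v where "v = unit_ball_vol n"
  have v: "v \<ge> 0" by (simp add: v_def n_def)
  have vol: "emeasure lborel (ball x0 (c k)) = ennreal (v * c k powr n)" for k
    using c[of k] by (simp add: emeasure_ball v_def n_def powr_realpow)
  define A where "A = (LINT x|lborel. f x powr q)"
  \<comment> \<open>Both parts of the integrand qualify as \<open>g\<close>: they vanish when
    \<open>x\<close> and \<open>y\<close> lie outside the ball carrying the tent.\<close>
  have bound: "(\<integral>\<^sup>+z. ennreal (norm (f (fst z) * g z)) \<partial>?M) \<le>
      ennreal (2 * T * (v * c k powr n) * (R powr (- \<alpha>) * K) + T powr (1 - q) * A * (R powr (- \<alpha>) * K))"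
    if "T > 0" "R > 0" "\<And>x y. \<bar>g (x, y)\<bar> \<le> jump_kernel \<alpha> R (y - x)"
      "\<And>x y. x \<notin> ball x0 (c k) \<Longrightarrow> y \<notin> ball x0 (c k) \<Longrightarrow> g (x, y) = 0" for T R g k
    unfolding A_def using that K v q f0 fint vol
    by (intro nn_integral_weighted_kernel_le[where \<kappa> = "jump_kernel \<alpha> R" and B = "ball x0 (c k)"])
       (auto intro: jump_kernel_nonneg)
  \<comment> \<open>Only finiteness matters here, so \<open>T = 1\<close>; the scale is the ramp
    width \<open>1 / c k\<close>.\<close>
  have P: "integrable ?M (P k)" for k
  proof (rule integrableI_bounded)
    show "(\<integral>\<^sup>+z. ennreal (norm (P k z)) \<partial>?M) < \<infinity>"
      unfolding P_def
      by (rule le_less_trans[OF bound[of 1 "1 / c k" _ k]])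
         (use c[of k] transport_le[OF \<nu>] in \<open>auto simp: transport_def tent_eq_0\<close>)
  qed measurable
  define err where "err k T = 2 * T * (v * c k powr n) * (c k powr (- \<alpha>) * K) + T powr (1 - q) * A * (c k powr (- \<alpha>) * K)" for k T
  have Eb: "(\<integral>\<^sup>+z. ennreal (norm (E k z)) \<partial>?M) \<le> ennreal (err k T)" if "T > 0" for k T
    unfolding E_def err_def
    by (rule bound) (use c[of k] cutoff_error_le[OF \<nu>] that in \<open>auto simp: cutoff_error_def tent_eq_0\<close>)
  have E: "integrable ?M (E k)" for k
    using le_less_trans[OF Eb[of 1 k]] by (intro integrableI_bounded) auto
  have A0: "A \<ge> 0" unfolding A_def by simp
  have Ele: "\<bar>integral\<^sup>L ?M (E k)\<bar> \<le> err k T" if T: "T > 0" for k T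
  proof -
    have "ennreal (norm (integral\<^sup>L ?M (E k))) \<le> (\<integral>\<^sup>+z. ennreal (norm (E k z)) \<partial>?M)"
      by (rule integral_norm_bound_ennreal[OF E])
    also have "\<dots> \<le> ennreal (err k T)" by (rule Eb[OF T])
    finally show ?thesis
      using T v K A0 by (subst (asm) ennreal_le_iff) (auto simp: err_def intro!: add_nonneg_nonneg mult_nonneg_nonneg)
  qed
  have n1: "n \<ge> 1" by (simp add: n_def Suc_leI)
  \<comment> \<open>The threshold will be \<open>T = c k powr (- s)\<close>, which turns the two
    terms of \<open>err\<close> into powers of \<open>c k\<close> with exponents
    \<open>n - \<alpha> - s\<close> and \<open>s * (q - 1) - \<alpha>\<close>. Both are negative for
    \<open>s\<close> between \<open>n - \<alpha>\<close> and \<open>\<alpha> / (q - 1)\<close>, a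
    nonempty range exactly when \<open>q * (n - \<alpha>) < n\<close>. For \<open>q = 1\<close> the
    upper constraint is automatic and \<open>s = n\<close> serves.\<close>
  obtain s where s: "n - \<alpha> < s" "s * (q - 1) < \<alpha>"
  proof (cases "q = 1")
    case True
    then show ?thesis using that[of "n"] a by simp
  next
    case False
    have "(n - \<alpha>) * (q - 1) < \<alpha>"
      using q(2) by (simp add: n_def algebra_simps)
    then have "n - \<alpha> < \<alpha> / (q - 1)"
      using q(1) False by (simp add: pos_less_divide_eq)
    then obtain s where "n - \<alpha> < s" "s < \<alpha> / (q - 1)" using dense by blast
    then show ?thesis using that[of s] q False by (simp add: pos_less_divide_eq)
  qed
  have errlim: "(\<lambda>k. err k (c k powr (- s))) \<longlonglongrightarrow> 0"
  proof -
    have "filterlim c at_top sequentially"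
      unfolding c_def using filterlim_real_sequentially filterlim_sequentially_Suc by blast
    then have pw: "(\<lambda>k. c k powr e) \<longlonglongrightarrow> 0" if "e < 0" for e
      using that by (rule tendsto_neg_powr[rotated])
    have "(\<lambda>k. 2 * v * K * c k powr (n - \<alpha> - s) + A * K * c k powr (s * (q - 1) - \<alpha>)) \<longlonglongrightarrow>
        2 * v * K * 0 + A * K * 0"
      using s by (intro tendsto_add tendsto_mult_left pw) auto
    moreover have "err k (c k powr (- s)) = 2 * v * K * c k powr (n - \<alpha> - s) + A * K * c k powr (s * (q - 1) - \<alpha>)" for k
    proof -
      have "c k powr (n - \<alpha> - s) = c k powr (-s) * c k powr n * c k powr (-\<alpha>)"
        by (simp add: powr_add[symmetric] algebra_simps)
      moreover have "c k powr (s * (q - 1) - \<alpha>) = (c k powr (-s)) powr (1 - q) * c k powr (-\<alpha>)"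
        by (simp add: powr_powr powr_add[symmetric] algebra_simps)
      ultimately show ?thesis by (simp add: err_def)
    qed
    ultimately show ?thesis by simp
  qed
  have Elim: "(\<lambda>k. integral\<^sup>L ?M (E k)) \<longlonglongrightarrow> 0"
    by (rule Lim_null_comparison[OF _ errlim]) (auto intro!: always_eventually Ele simp: c_def)
  define m where "m = frac_const DIM('a) \<alpha>"
  have m: "m > 0" using a by (simp add: m_def frac_const_pos)
  \<comment> \<open>The identity \<open>ibp\<close> for the cut-off field is divided by
    \<open>m\<close> and solved for the nonnegative part. Integrability of \<open>P k\<close> and
    \<open>E k\<close> on the product turns the iterated integral into a product integral.\<close>
  have split: "integral\<^sup>L ?M (P k) = - (vector_integral D (cutoff \<nu> x0 (c k)) / m) - integral\<^sup>L ?M (E k)" for k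
  proof -
    have "f x * frac_div \<alpha> (cutoff \<nu> x0 (c k)) x = m * (LINT y|lborel. P k (x, y) + E k (x, y))" for x
      unfolding frac_div_cutoff P_def E_def fst_conv m_def
      by (simp add: distrib_left[symmetric] del: distrib_left)
    then have "- vector_integral D (cutoff \<nu> x0 (c k)) =
        m * (LINT x|lborel. LINT y|lborel. P k (x, y) + E k (x, y))"
      using ibp[OF cutoff_Lip_c[OF \<nu> c] borel_measurable_cutoff, of x0 k] by simp
    also have "(LINT x|lborel. LINT y|lborel. P k (x, y) + E k (x, y)) =
        (LINT z|?M. P k z + E k z)"
      using P E by (intro lborel_pair.integral_fst' Bochner_Integration.integrable_add)
    also have "\<dots> = integral\<^sup>L ?M (P k) + integral\<^sup>L ?M (E k)"
      using P E by (rule Bochner_Integration.integral_add)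
    finally show ?thesis using m by (simp add: field_simps)
  qed
  have "(\<lambda>k. - (vector_integral D (cutoff \<nu> x0 (c k)) / m) - integral\<^sup>L ?M (E k)) \<longlonglongrightarrow> - (\<nu> \<bullet> 0 / m) - 0"
    using vector_integral_cutoff_tendsto[OF V, of \<nu> x0] m unfolding H c_def[symmetric]
    by (intro tendsto_diff tendsto_minus tendsto_divide tendsto_const Elim) auto
  then have Plim: "(\<lambda>k. integral\<^sup>L ?M (P k)) \<longlonglongrightarrow> 0"
    by (simp add: split)
  have P0: "0 \<le> P k z" for k z
    unfolding P_def by (intro mult_nonneg_nonneg f0 transport_nonneg c)
  let ?L = "\<lambda>(x, y). f x * ((indicator (halfspace \<nu> x0) y - indicator (halfspace \<nu> x0) x) * direction_kernel \<alpha> \<nu> (y - x))"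
  \<comment> \<open>Fatou: the nonnegative integrands have integrals tending to 0, so their
    pointwise limit \<open>?L\<close> cannot be positive on a set of positive measure.\<close>
  have "(\<integral>\<^sup>+z. liminf (\<lambda>k. ennreal (P k z)) \<partial>?M) \<le> liminf (\<lambda>k. \<integral>\<^sup>+z. ennreal (P k z) \<partial>?M)"
    by (rule nn_integral_liminf) measurable
  also have "(\<lambda>k. \<integral>\<^sup>+z. ennreal (P k z) \<partial>?M) = (\<lambda>k. ennreal (integral\<^sup>L ?M (P k)))"
    using P P0 by (intro ext nn_integral_eq_integral) auto
  also have "liminf \<dots> = 0"
    using tendsto_ennrealI[OF Plim] by (simp add: lim_imp_Liminf)
  finally have "(\<integral>\<^sup>+z. liminf (\<lambda>k. ennreal (P k z)) \<partial>?M) = 0" by simp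
  then have "AE z in ?M. liminf (\<lambda>k. ennreal (P k z)) = 0"
    by (subst (asm) nn_integral_0_iff_AE) auto
  moreover have "liminf (\<lambda>k. ennreal (P k z)) = ennreal (?L z)" for z
  proof (cases z)
    case (Pair x y)
    have "(\<lambda>k. P k z) \<longlonglongrightarrow> ?L z"
      unfolding Pair P_def prod.case fst_conv c_def
      by (intro tendsto_mult_left transport_tendsto)
    then show ?thesis by (intro lim_imp_Liminf tendsto_ennrealI) auto
  qed
  \<comment> \<open>\<open>ennreal\<close> sends all nonpositive reals to 0, so what is extracted is
    an inequality.\<close>
  ultimately have "AE z in ?M. ?L z \<le> 0"
    by (simp add: ennreal_eq_0_iff)
  then have "AE x in lborel. AE y in lborel. ?L (x, y) \<le> 0"
    by (rule lborel_pair.AE_pair)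
  then show ?thesis
  proof (rule AE_mp, intro AE_I2 impI)
    fix x assume AE: "AE y in lborel. ?L (x, y) \<le> 0"
    have kpos: "direction_kernel \<alpha> \<nu> z > 0" if "z \<bullet> \<nu> > 0" for z
      using that by (auto simp: direction_kernel_def intro!: divide_pos_pos)
    have kneg: "direction_kernel \<alpha> \<nu> z < 0" if "z \<bullet> \<nu> < 0" for z
      using that by (auto simp: direction_kernel_def intro!: divide_neg_pos)
    have \<nu>\<nu>: "\<nu> \<bullet> \<nu> = 1" using \<nu> by (simp add: dot_square_norm)
    show "f x = 0"
    proof (rule ccontr)
      assume "f x \<noteq> 0"
      then have fx: "f x > 0" using f0[of x] by simp
      show False
      \<comment> \<open>Points \<open>y\<close> strictly across the boundary hyperplane make
        \<open>?L (x, y)\<close> positive: the indicator difference and the kernel have the same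
        sign. The set \<open>?U\<close> of such \<open>y\<close> is open and contains
        \<open>x0 - \<nu>\<close> or \<open>x0 + \<nu>\<close>, so it is not null.\<close>
      proof (cases "x \<in> halfspace \<nu> x0")
        case True
        let ?U = "{y. (y - x0) \<bullet> \<nu> < 0}"
        have "AE y in lborel. y \<notin> ?U"
          using AE
        proof (rule AE_mp, intro AE_I2 impI notI)
          fix y assume y: "?L (x, y) \<le> 0" "y \<in> ?U"
          then have "(y - x) \<bullet> \<nu> < 0" "y \<notin> halfspace \<nu> x0"
            using True by (auto simp: halfspace_def inner_diff_left)
          then show False
            using y True mult_pos_neg[OF fx kneg[of "y - x"]] by simp
        qed
        moreover have "open ?U" by (intro open_Collect_less continuous_intros)
        moreover have "x0 - \<nu> \<in> ?U" by (simp add: \<nu>\<nu>)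
        ultimately show False using AE_lborel_not_open by blast
      next
        case False
        let ?U = "halfspace \<nu> x0"
        have "AE y in lborel. y \<notin> ?U"
          using AE
        proof (rule AE_mp, intro AE_I2 impI notI)
          fix y assume y: "?L (x, y) \<le> 0" "y \<in> ?U"
          then have "(y - x) \<bullet> \<nu> > 0"
            using False by (auto simp: halfspace_def inner_diff_left)
          then show False
            using y False mult_pos_pos[OF fx kpos[of "y - x"]] by simp
        qed
        moreover have "open ?U"
          unfolding halfspace_def by (intro open_Collect_less continuous_intros)
        moreover have "x0 + \<nu> \<in> ?U" by (simp add: \<nu>\<nu> halfspace_def)
        ultimately show False using AE_lborel_not_open by blast
      qed
    qed
  qed
qed


section \<open>Half-spaces from the three alternatives\<close>

lemma sets_halfspace: "halfspace \<nu> x0 \<in> sets borel"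
  unfolding halfspace_def by measurable

text \<open>If the support lies in the ball of radius \<open>R\<close>, the half-space
  \<open>y \<bullet> \<nu> > R\<close> misses it by Cauchy-Schwarz, for any unit vector
  \<open>\<nu>\<close>.\<close>

lemma bounded_support_imp_halfspace_zero:
  fixes D :: "'a::euclidean_space set \<Rightarrow> 'b::real_normed_vector"
  assumes V: "vector_measure D" and "bounded (variation_support D)"
  shows "\<exists>x0 \<nu>. norm \<nu> = 1 \<and> D (halfspace \<nu> x0) = 0"
proof -
  obtain R where R: "\<And>x. x \<in> variation_support D \<Longrightarrow> norm x \<le> R"
    using assms(2) unfolding bounded_iff by blast
  obtain \<nu> :: 'a where \<nu>: "norm \<nu> = 1" using nonempty_Basis norm_Basis by blast
  have "norm y > R" if "y \<in> halfspace \<nu> (R *\<^sub>R \<nu>)" for y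
  proof -
    have "R < y \<bullet> \<nu>"
      using that \<nu> by (simp add: halfspace_def inner_diff_left dot_square_norm)
    also have "\<dots> \<le> norm y" using norm_cauchy_schwarz[of y \<nu>] \<nu> by simp
    finally show ?thesis .
  qed
  then have "halfspace \<nu> (R *\<^sub>R \<nu>) \<inter> variation_support D = {}"
    using R by force
  then have "D (halfspace \<nu> (R *\<^sub>R \<nu>)) = 0"
    by (intro vector_measure_zero_off_support[OF V] sets_halfspace)
  then show ?thesis using \<nu> by blast
qed

theorem theorem1p4:
  fixes f :: "real ^ 'n \<Rightarrow> real" and \<alpha> :: real and p :: ennreal
    and D :: "(real ^ 'n) set \<Rightarrow> real ^ 'n"
  assumes "0 < \<alpha>" "\<alpha> < 1"
    and "1 \<le> p" "p < ennreal (real CARD('n) / (real CARD('n) - \<alpha>))"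
    and "f \<in> BV_plus \<alpha> p"
    and "has_frac_variation f \<alpha> D"
    and "bounded (variation_support D) \<or>
      (\<exists>x0 \<nu>. norm \<nu> = 1 \<and> variation D (closure (halfspace \<nu> x0)) = 0) \<or>
      (f \<in> Lp \<infinity> \<and> (\<exists>x0 \<nu>. norm \<nu> = 1 \<and> D (halfspace \<nu> x0) = 0))"
  shows "AE x in lebesgue. f x = 0"
proof -
  have V: "vector_measure D" using assms(6) by (simp add: has_frac_variation_def)
  \<comment> \<open>In the second alternative the open half-space lies in its closure, so the
    variation there dominates \<open>norm (D (halfspace \<nu> x0))\<close>. The first uses the
    bounded-support lemma; the third states the claim.\<close>
  have "\<exists>x0 \<nu>. norm \<nu> = 1 \<and> D (halfspace \<nu> x0) = 0"
    using assms(7)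
  proof (elim disjE exE conjE)
    fix x0 \<nu> :: "real ^ 'n" assume \<nu>: "norm \<nu> = 1" "variation D (closure (halfspace \<nu> x0)) = 0"
    have "ennreal (norm (D (halfspace \<nu> x0))) \<le> variation D (closure (halfspace \<nu> x0))"
      by (intro norm_le_variation[OF V] sets_halfspace closure_subset) auto
    then show ?thesis using \<nu> by auto
  qed (use bounded_support_imp_halfspace_zero[OF V] in auto)
  then obtain x0 \<nu> where H: "norm \<nu> = 1" "D (halfspace \<nu> x0) = 0" by blast
  define q where "q = enn2real p"
  have nn: "real CARD('n) - \<alpha> > 0"
    using assms(2) by (smt (verit) of_nat_1 of_nat_le_iff One_nat_def Suc_leI zero_less_card_finite)
  have "p < top" using assms(4) ennreal_less_top by (rule less_trans)
  then have p: "p = ennreal q" "p \<noteq> \<infinity>"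
    by (simp_all add: q_def)
  have q0: "0 \<le> q" by (simp add: q_def)
  have q: "1 \<le> q" "q < real CARD('n) / (real CARD('n) - \<alpha>)"
    using assms(3,4) q0 unfolding p(1)
    by (simp_all add: ennreal_less_iff ennreal_1[symmetric] del: ennreal_1)
  then have q2: "q * (real CARD('n) - \<alpha>) < real CARD('n)"
    using nn by (simp add: pos_less_divide_eq)
  have f [measurable]: "f \<in> borel_measurable lebesgue"
    and fint: "integrable lebesgue (\<lambda>x. \<bar>f x\<bar> powr q)" and f0: "AE x in lebesgue. 0 \<le> f x"
    using assms(5) p(2) by (auto simp: BV_plus_def BV_def Lp_def q_def)
  \<comment> \<open>\<open>f\<close> is replaced by a Borel representative, truncated at 0 to make
    nonnegativity hold everywhere. This alters \<open>f\<close> only on a null set, so neither the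
    pairings with \<open>frac_div\<close> nor the conclusion changes.\<close>
  obtain g0 where g0 [measurable]: "g0 \<in> borel_measurable lborel" and fg0: "AE x in lborel. f x = g0 x"
    using completion_ex_borel_measurable_real[OF f] by blast
  define g where "g x = max 0 (g0 x)" for x
  have g [measurable]: "g \<in> borel_measurable borel" using g0 unfolding g_def by measurable
  then have gl [measurable]: "g \<in> borel_measurable lebesgue" by (simp add: measurable_completion)
  have fg: "AE x in lebesgue. f x = g x"
    using f0 AE_completion[OF fg0] by eventually_elim (auto simp: g_def)
  have "integrable lebesgue (\<lambda>x. g x powr q)"
    using fint
  proof (rule integrable_cong_AE_imp)
    show "AE x in lebesgue. \<bar>f x\<bar> powr q = g x powr q"
      using fg f0 by eventually_elim auto
  qed measurable
  then have gint: "integrable lborel (\<lambda>x. g x powr q)"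
    by (subst (asm) integrable_completion) auto
  have "AE x in lborel. g x = 0"
  proof (rule halfspace_zero_imp_AE_zero[OF assms(1,2) q(1) _ g _ gint V _ H])
    show "q * (real DIM(real ^ 'n) - \<alpha>) < real DIM(real ^ 'n)" using q2 by simp
    show "0 \<le> g x" for x by (simp add: g_def)
    fix \<phi> :: "real ^ 'n \<Rightarrow> real ^ 'n" assume \<phi>: "\<phi> \<in> Lip_c" "\<phi> \<in> borel_measurable borel"
    note [measurable] = borel_measurable_frac_div[OF \<phi>(2), of \<alpha>]
    have [measurable]: "frac_div \<alpha> \<phi> \<in> borel_measurable lebesgue"
      by (simp add: measurable_completion)
    have "(LINT x|lborel. g x * frac_div \<alpha> \<phi> x) = (LINT x|lebesgue. g x * frac_div \<alpha> \<phi> x)"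
      by (subst integral_completion) auto
    also have "\<dots> = (LINT x|lebesgue. f x * frac_div \<alpha> \<phi> x)"
      using fg by (intro integral_cong_AE) (auto elim: eventually_mono)
    also have "\<dots> = - vector_integral D \<phi>"
      using assms(6) \<phi> by (simp add: has_frac_variation_def)
    finally show "(LINT x|lborel. g x * frac_div \<alpha> \<phi> x) = - vector_integral D \<phi>" .
  qed
  from AE_completion[OF this] fg show ?thesis by eventually_elim simp
qed

end
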